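(* Let $r\le n$ be positive integers and let $\mathcal{A}_{n,r}$ be a generic arrangement of $r$ hyperplanes in $\mathbb{C}^n$. Then for every integer $m\ge 0$, the graded Betti numbers ($u$ = homological degree, $k$ = polynomial degree) are $$\beta^{(m)}_{u,k}(\mathcal{A}_{n,r})=\begin{cases}0 & \text{if } u>0,\\[2pt] \binom{r}{k}\left(\!\binom{n-r+k}{m-k}\!\right) & \text{if } u=0,\end{cases}$$ and $$\mathcal{P}\bigl(\mathcal{D}(\mathcal{A}_{n,r})\bigr)(a,b,t)=\frac{(1-a+ab)^r}{(1-a)^n},\qquad \mathcal{H}\bigl(\mathcal{D}(\mathcal{A}_{n,r})\bigr)(a,b)=\frac{(1-a+ab)^r}{(1-a)^n(1-b)^{n}},$$ $$\mathcal{P}\bigl(\mathcal{D}^{(m)}(\mathcal{A}_{n,r})\bigr)(b,t)=[a^m]\frac{(1-a+ab)^r}{(1-a)^n},\qquad \mathcal{H}\bigl(\mathcal{D}^{(m)}(\mathcal{A}_{n,r})\bigr)(b)=[a^m]\frac{(1-a+ab)^r}{(1-a)^n(1-b)^{n}}.$$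
   Context: Let $S=\mathbb{C}[x_1,\dots,x_n]$. A (central) $n$-arrangement $\mathcal{A}$ of $r$ hyperplanes is a set of $r$ distinct hyperplanes through the origin in $\mathbb{C}^n$, with defining polynomial $p=p_1\cdots p_r\in S$, where the $p_i$ are nonzero linear forms defining the hyperplanes. It is generic if every intersection of $s\le n$ of its hyperplanes has codimension $s$. Write $\partial^\alpha=\partial_1^{\alpha_1}\cdots\partial_n^{\alpha_n}$ and $|\alpha|=\alpha_1+\dots+\alpha_n$ for $\alpha\in\mathbb{N}^n$, and let $\delta*v$ denote the action of a differential operator $\delta$ with polynomial coefficients on $v\in S$. With $\langle p\rangle$ the principal ideal of $S$ generated by $p$, define $$\mathcal{D}(\mathcal{A})=\Bigl\{\delta=\sum_{\alpha}c_\alpha\partial^\alpha \text{ (finite sum)}: c_\alpha\in S,\ \delta*\langle p\rangle\subseteq\langle p\rangle\Bigr\},$$ $$\mathcal{D}^{(m)}(\mathcal{A})=\Bigl\{\delta=\sum_{|\alpha|=m}c_\alpha\partial^\alpha : c_\alpha\in S,\ \delta*\langle p\rangle\subseteq\langle p\rangle\Bigr\}.$$ It is known that $\mathcal{D}(\mathcal{A})=\bigoplus_{m\ge0}\mathcal{D}^{(m)}(\mathcal{A})$, with $\mathcal{D}^{(0)}(\mathcal{A})=S$. Each $\mathcal{D}^{(m)}(\mathcal{A})$ is a finitely generated graded $S$-module, graded by polynomial degree: $\sum c_\alpha\partial^\alpha$ is homogeneous of degree $v$ if all nonzero $c_\alpha$ are homogeneous of degree $v$. Let $\beta^{(m)}_{j,i}$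 be the number of copies of $S(-i)$ in homological degree $j$ of the minimal graded free resolution of $\mathcal{D}^{(m)}(\mathcal{A})$ over $S$ (so $\beta^{(m)}_{0,i}$ counts minimal generators of degree $i$). Define the Poincaré–Betti and Hilbert series by $$\mathcal{P}(\mathcal{D}^{(m)}(\mathcal{A}))(b,t)=\sum_{j,i}\beta^{(m)}_{j,i}b^it^j,\qquad \mathcal{P}(\mathcal{D}(\mathcal{A}))(a,b,t)=\sum_{m\ge0}a^m\,\mathcal{P}(\mathcal{D}^{(m)}(\mathcal{A}))(b,t),$$ $$\mathcal{H}(\mathcal{D}^{(m)}(\mathcal{A}))(b)=(1-b)^{-n}\mathcal{P}(\mathcal{D}^{(m)}(\mathcal{A}))(b,-1),\qquad \mathcal{H}(\mathcal{D}(\mathcal{A}))(a,b)=(1-b)^{-n}\mathcal{P}(\mathcal{D}(\mathcal{A}))(a,b,-1).$$ Notation: $\left(\!\binom{c}{d}\!\right)=\binom{c+d-1}{d}$ is the number of multisets of weight $d$ on a set with $c$ elements (so it is $0$ for $d<0$, and $\left(\!\binom{0}{0}\!\right)=1$). $[a^m]f$ denotes the coefficient of $a^m$ in the formal power series $f$. *)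

theory Defs
  imports "HOL-Analysis.Analysis" "HOL-Library.Poly_Mapping"
begin

section \<open>Polynomials in the variables indexed by a finite type\<close>

text \<open>
  For a finite type \<open>'n\<close> with \<open>n = CARD('n)\<close> elements, \<open>'n cpoly\<close> is the
  polynomial ring in \<open>n\<close> variables over the complex numbers; the commutative ring
  structure is the convolution structure of \<^theory>\<open>HOL-Library.Poly_Mapping\<close>.
\<close>

type_synonym 'n cpoly = "('n \<Rightarrow>\<^sub>0 nat) \<Rightarrow>\<^sub>0 complex"

definition mdeg :: "('n::finite \<Rightarrow>\<^sub>0 nat) \<Rightarrow> nat" where
  "mdeg \<alpha> = (\<Sum>i\<in>UNIV. Poly_Mapping.lookup \<alpha> i)"

definition homogeneous :: "nat \<Rightarrow> 'n::finite cpoly \<Rightarrow> bool" where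
  "homogeneous v f \<longleftrightarrow> (\<forall>\<alpha>\<in>Poly_Mapping.keys f. mdeg \<alpha> = v)"

definition poly_value :: "'n::finite cpoly \<Rightarrow> complex ^ 'n \<Rightarrow> complex" where
  "poly_value f z = (\<Sum>\<alpha>\<in>Poly_Mapping.keys f. Poly_Mapping.lookup f \<alpha> * (\<Prod>i\<in>UNIV. (z $ i) ^ Poly_Mapping.lookup \<alpha> i))"

definition partial_deriv :: "'n \<Rightarrow> 'n cpoly \<Rightarrow> 'n cpoly" where
  "partial_deriv i f =
     (\<Sum>\<alpha>\<in>Poly_Mapping.keys f. Poly_Mapping.single (\<alpha> - Poly_Mapping.single i 1)
                       (of_nat (Poly_Mapping.lookup \<alpha> i) * Poly_Mapping.lookup f \<alpha>))"

text \<open>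
  The operator \<open>\<partial>\<^sup>\<alpha>\<close> is the composition of the powers of all partial derivatives.
  The use of \<^const>\<open>Finite_Set.fold\<close> is legitimate because these powers commute, see
  the lemma \<open>comp_fun_commute_partial_deriv\<close>.
\<close>

definition multi_deriv :: "('n::finite \<Rightarrow>\<^sub>0 nat) \<Rightarrow> 'n cpoly \<Rightarrow> 'n cpoly" where
  "multi_deriv \<alpha> f = Finite_Set.fold (\<lambda>i. partial_deriv i ^^ Poly_Mapping.lookup \<alpha> i) f UNIV"

lemma lookup_partial_deriv:
  "Poly_Mapping.lookup (partial_deriv i f) \<beta> =
     of_nat (Suc (Poly_Mapping.lookup \<beta> i)) * Poly_Mapping.lookup f (\<beta> + Poly_Mapping.single i 1)"
proof -
  let ?e = "Poly_Mapping.single i (1::nat)"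
  have *: "(\<alpha> - ?e = \<beta> \<and> Poly_Mapping.lookup \<alpha> i \<noteq> 0) \<longleftrightarrow> \<alpha> = \<beta> + ?e" for \<alpha>
  proof
    assume "\<alpha> - ?e = \<beta> \<and> Poly_Mapping.lookup \<alpha> i \<noteq> 0"
    then show "\<alpha> = \<beta> + ?e"
      by (intro poly_mapping_eqI)
         (auto simp: lookup_add lookup_minus lookup_single when_def split: if_splits)
  qed (auto simp: lookup_add)
  have "Poly_Mapping.lookup (partial_deriv i f) \<beta> =
          (\<Sum>\<alpha>\<in>Poly_Mapping.keys f. if \<alpha> = \<beta> + ?e then of_nat (Poly_Mapping.lookup \<alpha> i) * Poly_Mapping.lookup f \<alpha> else 0)"
    unfolding partial_deriv_def lookup_sum
  proof (rule sum.cong)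
    fix \<alpha>
    show "Poly_Mapping.lookup (Poly_Mapping.single (\<alpha> - ?e) (of_nat (Poly_Mapping.lookup \<alpha> i) * Poly_Mapping.lookup f \<alpha>)) \<beta> =
            (if \<alpha> = \<beta> + ?e then of_nat (Poly_Mapping.lookup \<alpha> i) * Poly_Mapping.lookup f \<alpha> else 0)"
      using *[of \<alpha>] by (cases "Poly_Mapping.lookup \<alpha> i = 0") (auto simp: lookup_single when_def)
  qed simp
  also have "\<dots> = of_nat (Suc (Poly_Mapping.lookup \<beta> i)) * Poly_Mapping.lookup f (\<beta> + ?e)"
    by (auto simp: sum.delta lookup_add in_keys_iff)
  finally show ?thesis .
qed

lemma partial_deriv_commute:
  "partial_deriv i (partial_deriv j f) = partial_deriv j (partial_deriv i f)"
  by (rule poly_mapping_eqI)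
     (auto simp: lookup_partial_deriv lookup_add lookup_single when_def ac_simps)

lemma comp_fun_commute_partial_deriv:
  fixes e :: "'n \<Rightarrow> nat"
  shows "comp_fun_commute (\<lambda>i. partial_deriv i ^^ e i)"
proof
  fix i j :: 'n
  have 1: "partial_deriv i ((partial_deriv j ^^ l) f) = (partial_deriv j ^^ l) (partial_deriv i f)"
    for l f by (induction l) (simp_all add: partial_deriv_commute[of i j])
  have "(partial_deriv j ^^ l) ((partial_deriv i ^^ k) f) =
        (partial_deriv i ^^ k) ((partial_deriv j ^^ l) f)" for k l f
    by (induction k) (simp_all add: 1[symmetric])
  then show "(partial_deriv j ^^ e j) \<circ> (partial_deriv i ^^ e i) =
             (partial_deriv i ^^ e i) \<circ> (partial_deriv j ^^ e j)"
    by (simp add: fun_eq_iff)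
qed

section \<open>Arrangements\<close>

definition central_hyperplane :: "(complex ^ 'n) set \<Rightarrow> bool" where
  "central_hyperplane H \<longleftrightarrow> vec.subspace H \<and> vec.dim H + 1 = CARD('n)"

definition arrangement :: "(complex ^ 'n) set set \<Rightarrow> bool" where
  "arrangement \<A> \<longleftrightarrow> finite \<A> \<and> (\<forall>H\<in>\<A>. central_hyperplane H)"

definition generic_arrangement :: "(complex ^ 'n) set set \<Rightarrow> bool" where
  "generic_arrangement \<A> \<longleftrightarrow>
     arrangement \<A> \<and>
     (\<forall>\<B>\<subseteq>\<A>. card \<B> \<le> CARD('n) \<longrightarrow> vec.dim (\<Inter>\<B>) + card \<B> = CARD('n))"

definition defining_form :: "(complex ^ 'n) set \<Rightarrow> 'n cpoly \<Rightarrow> bool" where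
  "defining_form H l \<longleftrightarrow> l \<noteq> 0 \<and> homogeneous 1 l \<and> H = {z. poly_value l z = 0}"

definition defining_polynomial :: "(complex ^ 'n) set set \<Rightarrow> 'n cpoly \<Rightarrow> bool" where
  "defining_polynomial \<A> p \<longleftrightarrow>
     (\<exists>l. (\<forall>H\<in>\<A>. defining_form H (l H)) \<and> p = (\<Prod>H\<in>\<A>. l H))"

section \<open>Differential operators\<close>

text \<open>
  A differential operator \<open>\<Sum>\<^sub>\<alpha> c\<^sub>\<alpha> \<partial>\<^sup>\<alpha>\<close> is represented by the finitely supported family
  of its (uniquely determined) coefficients \<open>c\<^sub>\<alpha>\<close>. Addition of families is addition of
  operators, and left multiplication of an operator by a polynomial is \<open>scale\<close> below. The
  convolution product on this type is not the composition of operators and is never used.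
\<close>

type_synonym 'n diff_op = "('n \<Rightarrow>\<^sub>0 nat) \<Rightarrow>\<^sub>0 'n cpoly"

definition op_apply :: "'n::finite diff_op \<Rightarrow> 'n cpoly \<Rightarrow> 'n cpoly" where
  "op_apply \<delta> v = (\<Sum>\<alpha>\<in>Poly_Mapping.keys \<delta>. Poly_Mapping.lookup \<delta> \<alpha> * multi_deriv \<alpha> v)"

definition principal_ideal :: "'n cpoly \<Rightarrow> 'n cpoly set" where
  "principal_ideal p = {f * p |f. True}"

definition arr_ops :: "'n::finite cpoly \<Rightarrow> 'n diff_op set" where
  "arr_ops p = {\<delta>. op_apply \<delta> ` principal_ideal p \<subseteq> principal_ideal p}"

definition arr_ops_order :: "'n::finite cpoly \<Rightarrow> nat \<Rightarrow> 'n diff_op set" where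
  "arr_ops_order p m = {\<delta> \<in> arr_ops p. \<forall>\<alpha>\<in>Poly_Mapping.keys \<delta>. mdeg \<alpha> = m}"

section \<open>Minimal graded free resolutions and Betti numbers\<close>

text \<open>
  The finitely supported families \<open>'k \<Rightarrow>\<^sub>0 'n cpoly\<close> form the free module with basis
  \<open>'k\<close>. If the basis element \<open>k\<close> is given degree \<open>w k\<close>, i.e. generates a copy of
  \<open>S(-w k)\<close>, then \<open>graded_elem w v x\<close> says that \<open>x\<close> is homogeneous of degree \<open>v\<close>
  (zero being homogeneous of every degree).
\<close>

definition scale :: "'n cpoly \<Rightarrow> ('k \<Rightarrow>\<^sub>0 'n cpoly) \<Rightarrow> ('k \<Rightarrow>\<^sub>0 'n cpoly)" where
  "scale s x = Poly_Mapping.map (\<lambda>c. s * c) x"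

definition graded_elem :: "('k \<Rightarrow> nat) \<Rightarrow> nat \<Rightarrow> ('k \<Rightarrow>\<^sub>0 'n::finite cpoly) \<Rightarrow> bool" where
  "graded_elem w v x \<longleftrightarrow> (\<forall>k\<in>Poly_Mapping.keys x. \<forall>\<alpha>\<in>Poly_Mapping.keys (Poly_Mapping.lookup x k). mdeg \<alpha> + w k = v)"

definition free_mod :: "nat \<Rightarrow> (nat \<Rightarrow>\<^sub>0 'n cpoly) set" where
  "free_mod b = {x. Poly_Mapping.keys x \<subseteq> {..<b}}"

definition irrelevant_ideal :: "'n cpoly set" where
  "irrelevant_ideal = {f. Poly_Mapping.lookup f 0 = 0}"

lemma lookup_scale: "Poly_Mapping.lookup (scale s x) k = s * Poly_Mapping.lookup x k"
  by (simp add: scale_def map.rep_eq when_def)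

lemma module_scale:
  "module (scale :: 'n cpoly \<Rightarrow> ('k \<Rightarrow>\<^sub>0 'n cpoly) \<Rightarrow> ('k \<Rightarrow>\<^sub>0 'n cpoly))"
  by unfold_locales
     (auto intro!: poly_mapping_eqI simp: lookup_scale lookup_add algebra_simps)

text \<open>
  The following describes a minimal graded free resolution
  \<open>\<dots> \<rightarrow> F\<^sub>1 \<rightarrow> F\<^sub>0 \<rightarrow> M \<rightarrow> 0\<close> of a graded submodule \<open>M\<close> of a free module whose basis
  elements have degree 0. Here \<open>F\<^sub>j\<close> is \<open>free_mod (rk j)\<close>, free of rank \<open>rk j\<close>, its
  \<open>k\<close>-th basis element having degree \<open>dg j k\<close>; the map \<open>d j\<close> goes from \<open>F\<^sub>j\<^sub>+\<^sub>1\<close> to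
  \<open>F\<^sub>j\<close>. That the maps are linear on the whole ambient type is no restriction, since a
  linear map on \<open>F\<^sub>j\<close> extends by zero on the remaining basis elements; apart from linearity,
  only the values on \<open>F\<^sub>j\<close> matter. Negative degrees cannot occur in a minimal resolution of
  a module that lives in nonnegative degrees.
\<close>

locale minimal_graded_free_resolution =
  fixes M :: "('k \<Rightarrow>\<^sub>0 'n::finite cpoly) set"
    and rk :: "nat \<Rightarrow> nat"
    and dg :: "nat \<Rightarrow> nat \<Rightarrow> nat"
    and \<epsilon> :: "(nat \<Rightarrow>\<^sub>0 'n cpoly) \<Rightarrow> ('k \<Rightarrow>\<^sub>0 'n cpoly)"
    and d :: "nat \<Rightarrow> (nat \<Rightarrow>\<^sub>0 'n cpoly) \<Rightarrow> (nat \<Rightarrow>\<^sub>0 'n cpoly)"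
  assumes linear_\<epsilon>: "module_hom scale scale \<epsilon>"
    and linear_d: "\<And>j. module_hom scale scale (d j)"
    and graded_\<epsilon>: "\<And>v x. x \<in> free_mod (rk 0) \<Longrightarrow> graded_elem (dg 0) v x \<Longrightarrow>
                        graded_elem (\<lambda>_. 0) v (\<epsilon> x)"
    and graded_d: "\<And>j v x. x \<in> free_mod (rk (Suc j)) \<Longrightarrow> graded_elem (dg (Suc j)) v x \<Longrightarrow>
                        graded_elem (dg j) v (d j x)"
    and exact_M: "\<epsilon> ` free_mod (rk 0) = M"
    and exact_0: "d 0 ` free_mod (rk 1) = {x \<in> free_mod (rk 0). \<epsilon> x = 0}"
    and exact_Suc: "\<And>j. d (Suc j) ` free_mod (rk (Suc (Suc j))) =
                        {x \<in> free_mod (rk (Suc j)). d j x = 0}"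
    and minimal: "\<And>j x k. x \<in> free_mod (rk (Suc j)) \<Longrightarrow> Poly_Mapping.lookup (d j x) k \<in> irrelevant_ideal"

text \<open>
  The number of copies of \<open>S(-i)\<close> in homological degree \<open>j\<close>; for a finitely generated
  graded module it does not depend on the choice of the minimal resolution.
\<close>

definition betti :: "('k \<Rightarrow>\<^sub>0 'n::finite cpoly) set \<Rightarrow> nat \<Rightarrow> nat \<Rightarrow> nat" where
  "betti M j i =
     (THE c. \<exists>rk dg \<epsilon> d. minimal_graded_free_resolution M rk dg \<epsilon> d \<and>
                         c = card {k. k < rk j \<and> dg j k = i})"

section \<open>Poincare-Betti and Hilbert series\<close>

text \<open>
  Series in several variables are iterated formal power series: a series in \<open>a, b, t\<close> is a
  series in \<open>a\<close> over series in \<open>b\<close> over series in \<open>t\<close>, and a series in \<open>a, b\<close> is a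
  series in \<open>a\<close> over series in \<open>b\<close>. In both cases \<open>a\<close> is \<^term>\<open>fps_X\<close> and \<open>b\<close> is
  \<^term>\<open>fps_const fps_X\<close> at the respective types.
\<close>

definition poincare :: "('k \<Rightarrow>\<^sub>0 'n::finite cpoly) set \<Rightarrow> real fps fps" where
  "poincare M = Abs_fps (\<lambda>i. Abs_fps (\<lambda>j. real (betti M j i)))"

text \<open>
  The substitution \<open>t = -1\<close>. Since minimal resolutions over \<open>S\<close> have finite length, the
  coefficients to be evaluated are polynomials in \<open>t\<close>.
\<close>

definition at_minus_one :: "real fps fps \<Rightarrow> real fps" where
  "at_minus_one P = Abs_fps (\<lambda>i. eval_fps (fps_nth P i) (-1))"

definition hilbert :: "('k \<Rightarrow>\<^sub>0 'n::finite cpoly) set \<Rightarrow> real fps" where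
  "hilbert M = inverse ((1 - fps_X) ^ CARD('n)) * at_minus_one (poincare M)"

definition poincare_arr :: "'n::finite cpoly \<Rightarrow> real fps fps fps" where
  "poincare_arr p = Abs_fps (\<lambda>m. poincare (arr_ops_order p m))"

definition hilbert_arr :: "'n::finite cpoly \<Rightarrow> real fps fps" where
  "hilbert_arr p =
     fps_const (inverse ((1 - fps_X) ^ CARD('n))) *
     Abs_fps (\<lambda>m. at_minus_one (fps_nth (poincare_arr p) m))"

text \<open>
  The number of multisets of weight \<open>d\<close> on a set with \<open>c\<close> elements. Truncated subtraction
  on the natural numbers gives the values 1 for \<open>c = d = 0\<close> and 0 for \<open>c = 0 < d\<close>.
\<close>

definition multichoose :: "nat \<Rightarrow> int \<Rightarrow> nat" where
  "multichoose c d = (if d < 0 then 0 else (c + nat d - 1) choose nat d)"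

end

(*
  The forms defining the arrangement are linearly independent: if one of them were in the span
  of the others, the intersection of the other hyperplanes would be contained in its hyperplane,
  against genericity. They therefore extend to linear coordinates y, with dual derivations D and
  p the product of r of the coordinates. Write an operator of order m as a combination of the
  monomials Theta_alpha in the D_i, with coefficients c_alpha. Taking commutators with the y_j,
  which preserve the ideal, reduces to order 1 and shows that the operator preserves (p) iff
  y_i divides c_alpha for all i <= r in the support of alpha. Hence the operators
  (product of the y_i, i <= r in the support of alpha) * Theta_alpha form a homogeneous basis, and
  it remains to show that the resolution of a free module is trivial, and to count.
*)
theory Submission
  imports Defs
begin

text \<open>\<open>betti\<close> is a definite description over all minimal resolutions. Exhibiting
  the resolution of length 0 is therefore only half of the argument: every other minimal resolution
  must be shown to have the same degrees. The change of coordinates never leaves the original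
  polynomial ring. The \<open>y i\<close> stay polynomials in the old variables, and the locally
  nilpotent derivations \<open>D i\<close> take over the role of unique factorization: coprimality
  of distinct coordinates and cancellation of a coordinate from an equation are two cases of the
  single lemma \<open>dvd_D_cancel\<close>. The commutator formula \<open>L_commutator\<close> is
  likewise used twice, for the independence of the Theta monomials and for the divisibility of the
  coefficients. The degree k of a basis operator is the number of the r distinguished coordinates
  that occur in its Theta monomial, since the Theta monomial itself has constant coefficients in the
  old partial derivatives.\<close>

abbreviation (input) lookup where "lookup \<equiv> Poly_Mapping.lookup"
abbreviation (input) keys where "keys \<equiv> Poly_Mapping.keys"
abbreviation (input) single where "single \<equiv> Poly_Mapping.single"

section \<open>Betti numbers of free modules\<close>

interpretation scale: module "scale :: 'n cpoly \<Rightarrow> ('k \<Rightarrow>\<^sub>0 'n cpoly) \<Rightarrow> ('k \<Rightarrow>\<^sub>0 'n cpoly)"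
  by (rule module_scale)

section \<open>Order of vanishing at the origin, constant terms, homogeneous components\<close>

lemma mdeg_add: "mdeg (\<alpha> + \<beta>) = mdeg \<alpha> + mdeg \<beta>"
  by (simp add: mdeg_def lookup_add sum.distrib)

lemma mdeg_zero [simp]: "mdeg 0 = 0"
  by (simp add: mdeg_def)

lemma mdeg_eq_0_iff: "mdeg \<alpha> = 0 \<longleftrightarrow> \<alpha> = 0"
  by (auto simp: mdeg_def intro!: poly_mapping_eqI)

lemma keys_mult_obtain:
  assumes "lookup (f * g) \<alpha> \<noteq> 0"
  obtains \<beta> \<gamma> where "\<alpha> = \<beta> + \<gamma>" "lookup f \<beta> \<noteq> 0" "lookup g \<gamma> \<noteq> 0"
  using assms keys_mult[of f g] by (auto simp: in_keys_iff)

text \<open>Membership in the \<open>j\<close>-th power of the irrelevant ideal, expressed through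
  exponents so that no powers of ideals have to be formed.\<close>

definition order_ge :: "nat \<Rightarrow> 'n::finite cpoly \<Rightarrow> bool" where
  "order_ge j f \<longleftrightarrow> (\<forall>\<alpha>. lookup f \<alpha> \<noteq> 0 \<longrightarrow> j \<le> mdeg \<alpha>)"

lemma order_ge_sum: "(\<And>a. a \<in> A \<Longrightarrow> order_ge j (f a)) \<Longrightarrow> order_ge j (sum f A)"
  unfolding order_ge_def lookup_sum by (meson sum.neutral)

lemma order_ge_mult: "order_ge i f \<Longrightarrow> order_ge j g \<Longrightarrow> order_ge (i + j) (f * g)"
  unfolding order_ge_def by (metis keys_mult_obtain mdeg_add add_mono)

text \<open>The exponent \<open>\<alpha>\<close> is excluded at order
  \<open>Suc (mdeg \<alpha>)\<close>. This is the Krull intersection property that ends the argument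
  for \<open>kernel_trivial\<close>.\<close>

lemma order_ge_imp_zero: assumes "\<And>j. order_ge j f" shows "f = 0"
proof (rule poly_mapping_eqI)
  fix \<alpha> show "lookup f \<alpha> = lookup 0 \<alpha>"
    using assms[of "Suc (mdeg \<alpha>)"] by (auto simp: order_ge_def)
qed

lemma irrelevant_iff_order_ge: "f \<in> irrelevant_ideal \<longleftrightarrow> order_ge 1 f"
  by (auto simp: irrelevant_ideal_def order_ge_def Suc_le_eq mdeg_eq_0_iff neq0_conv[symmetric])

text \<open>Evaluation at the origin is multiplicative, which allows matrix identities to be reduced
  modulo the irrelevant ideal. Splitting off both constant terms avoids the convolution sum.\<close>

lemma lookup_mult_0:
  fixes f g :: "'n::finite cpoly"
  shows "lookup (f * g) 0 = lookup f 0 * lookup g 0"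
proof -
  define f' g' where "f' = f - single 0 (lookup f 0)" and "g' = g - single 0 (lookup g 0)"
  have f': "order_ge 1 f'" and g': "order_ge 1 g'"
    unfolding irrelevant_iff_order_ge[symmetric]
    by (simp_all add: f'_def g'_def lookup_minus irrelevant_ideal_def)
  have o0: "order_ge 0 h" for h :: "'n cpoly" by (simp add: order_ge_def)
  have "f * g = single 0 (lookup f 0 * lookup g 0) + f * g' + f' * single 0 (lookup g 0)"
    by (simp add: f'_def g'_def algebra_simps mult_single)
  moreover have "lookup (f * g') 0 = 0" "lookup (f' * single 0 (lookup g 0)) 0 = 0"
    using order_ge_mult[OF o0 g', of f] order_ge_mult[OF f' o0, of "single 0 (lookup g 0)"]
    by (auto simp: order_ge_def)
  ultimately show ?thesis by (simp add: lookup_add)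
qed

definition restrict_keys :: "('a \<Rightarrow> bool) \<Rightarrow> ('a \<Rightarrow>\<^sub>0 'b::comm_monoid_add) \<Rightarrow> ('a \<Rightarrow>\<^sub>0 'b)" where
  "restrict_keys P f = (\<Sum>\<alpha>\<in>{\<alpha>\<in>keys f. P \<alpha>}. single \<alpha> (lookup f \<alpha>))"

lemma lookup_restrict_keys: "lookup (restrict_keys P f) \<alpha> = (if P \<alpha> then lookup f \<alpha> else 0)"
  by (auto simp: restrict_keys_def lookup_sum lookup_single when_def sum.delta in_keys_iff)

text \<open>A homogeneous factor shifts all degrees by \<open>w\<close>, so taking a homogeneous
  component commutes with multiplication by it. The condition \<open>mdeg \<alpha> + w = v\<close>
  avoids the truncated difference \<open>v - w\<close>.\<close>

lemma lookup_restrict_keys_mult: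
  fixes f g :: "'n::finite cpoly"
  assumes "homogeneous w g"
  shows "lookup (restrict_keys (\<lambda>\<alpha>. mdeg \<alpha> + w = v) f * g) \<beta> =
           (if mdeg \<beta> = v then lookup (f * g) \<beta> else 0)"
proof -
  define f1 f2 where "f1 = restrict_keys (\<lambda>\<alpha>. mdeg \<alpha> + w = v) f" and "f2 = f - f1"
  have 1: "mdeg \<beta> = v" if "lookup (f1 * g) \<beta> \<noteq> 0" for \<beta>
    using that assms
    by (elim keys_mult_obtain)
       (auto simp: f1_def lookup_restrict_keys mdeg_add homogeneous_def in_keys_iff split: if_splits)
  have 2: "mdeg \<beta> \<noteq> v" if "lookup (f2 * g) \<beta> \<noteq> 0" for \<beta>
    using that assms
    by (elim keys_mult_obtain)
       (auto simp: f1_def f2_def lookup_minus lookup_restrict_keys mdeg_add homogeneous_def in_keys_iff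
         split: if_splits)
  have "f * g = f1 * g + f2 * g"
    by (simp add: f2_def algebra_simps)
  with 1[of \<beta>] 2[of \<beta>] show ?thesis
    by (auto simp: lookup_add f1_def[symmetric])
qed

section \<open>Elements of free modules\<close>

lemma sum_single_scale: "(\<Sum>k\<in>keys x. scale (lookup x k) (single k 1)) = x"
  by (rule poly_mapping_eqI)
     (auto simp: lookup_sum lookup_scale lookup_single when_def if_distrib[of "\<lambda>c. _ * c"]
       in_keys_iff cong: if_cong)

lemma free_mod_expand:
  assumes "x \<in> free_mod b"
  shows "(\<Sum>k<b. scale (lookup x k) (single k 1)) = x"
proof -
  have "(\<Sum>k<b. scale (lookup x k) (single k 1)) = (\<Sum>k\<in>keys x. scale (lookup x k) (single k 1))"
    using assms by (intro sum.mono_neutral_right) (auto simp: free_mod_def in_keys_iff)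
  then show ?thesis by (simp add: sum_single_scale)
qed

lemma free_mod_iff: "x \<in> free_mod b \<longleftrightarrow> (\<forall>k\<ge>b. lookup x k = 0)"
  by (auto simp: free_mod_def in_keys_iff subset_iff not_less[symmetric])

lemma free_mod_0: "free_mod 0 = {0}"
  by (auto simp: free_mod_iff intro!: poly_mapping_eqI)

lemma zero_in_free_mod: "0 \<in> free_mod b"
  by (simp add: free_mod_iff)

lemma single_in_free_mod: "k < b \<Longrightarrow> single k f \<in> free_mod b"
  by (auto simp: free_mod_iff lookup_single when_def)

lemma free_mod_diff: "x \<in> free_mod b \<Longrightarrow> y \<in> free_mod b \<Longrightarrow> x - y \<in> free_mod b"
  by (simp add: free_mod_iff lookup_minus)

lemma free_mod_scale: "x \<in> free_mod b \<Longrightarrow> scale s x \<in> free_mod b"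
  by (simp add: free_mod_iff lookup_scale)

lemma free_mod_sum: "(\<And>a. a \<in> A \<Longrightarrow> f a \<in> free_mod b) \<Longrightarrow> sum f A \<in> free_mod b"
  by (simp add: free_mod_iff lookup_sum)

lemma graded_elem_iff:
  "graded_elem w v x \<longleftrightarrow> (\<forall>k \<alpha>. lookup (lookup x k) \<alpha> \<noteq> 0 \<longrightarrow> mdeg \<alpha> + w k = v)"
proof -
  have "lookup x k \<noteq> 0" if "lookup (lookup x k) \<alpha> \<noteq> 0" for k \<alpha>
    using that by auto
  then show ?thesis by (auto simp: graded_elem_def in_keys_iff)
qed

section \<open>Modules with a homogeneous basis and their resolution of length 0\<close>

locale graded_basis =
  fixes M :: "('k \<Rightarrow>\<^sub>0 'n::finite cpoly) set"
    and N :: nat and B :: "nat \<Rightarrow> ('k \<Rightarrow>\<^sub>0 'n cpoly)" and w :: "nat \<Rightarrow> nat"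
  assumes independent: "\<And>c l. (\<Sum>l<N. scale (c l) (B l)) = 0 \<Longrightarrow> l < N \<Longrightarrow> c l = 0"
    and graded: "\<And>l. l < N \<Longrightarrow> graded_elem (\<lambda>_. 0) (w l) (B l)"
    and spanning: "M = range (\<lambda>c. \<Sum>l<N. scale (c l) (B l))"
begin

lemma coords_unique:
  assumes "(\<Sum>l<N. scale (c l) (B l)) = (\<Sum>l<N. scale (c' l) (B l))" "l < N"
  shows "c l = c' l"
  using independent[of "\<lambda>l. c l - c' l" l] assms
  by (simp add: scale.scale_left_diff_distrib sum_subtractf)

text \<open>Replacing every coefficient by its component of the matching degree represents the same
  homogeneous element. By uniqueness of coordinates nothing was lost, and a constant term survives
  only if \<open>0 + w l = v\<close>.\<close>

lemma coords_graded:
  assumes x: "graded_elem (\<lambda>_. 0) v (\<Sum>l<N. scale (c l) (B l))" and l: "l < N"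
    and nz: "lookup (c l) 0 \<noteq> 0"
  shows "w l = v"
proof -
  define c' where "c' l = restrict_keys (\<lambda>\<alpha>. mdeg \<alpha> + w l = v) (c l)" for l
  have hom: "homogeneous (w l) (lookup (B l) k)" if "l < N" for l k
    using graded[OF that] by (auto simp: graded_elem_iff homogeneous_def in_keys_iff)
  define X where "X = (\<Sum>l<N. scale (c l) (B l))"
  have X: "mdeg \<alpha> = v" if "lookup (lookup X k) \<alpha> \<noteq> 0" for k \<alpha>
    using x that unfolding X_def[symmetric] graded_elem_iff by simp
  have "(\<Sum>l<N. scale (c' l) (B l)) = X"
  proof (intro poly_mapping_eqI)
    fix k \<alpha>
    have "lookup (lookup (\<Sum>l<N. scale (c' l) (B l)) k) \<alpha> =
          (if mdeg \<alpha> = v then lookup (lookup X k) \<alpha> else 0)"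
      using hom by (simp add: X_def lookup_sum lookup_scale c'_def lookup_restrict_keys_mult)
    then show "lookup (lookup (\<Sum>l<N. scale (c' l) (B l)) k) \<alpha> = lookup (lookup X k) \<alpha>"
      using X[of k \<alpha>] by (cases "lookup (lookup X k) \<alpha> = 0") simp_all
  qed
  then have "c' l = c l"
    unfolding X_def by (rule coords_unique) (rule l)
  then have "lookup (c' l) 0 \<noteq> 0"
    using nz by simp
  then show ?thesis
    by (simp add: c'_def lookup_restrict_keys split: if_splits)
qed

lemma basis_in: "l < N \<Longrightarrow> B l \<in> M"
proof -
  assume "l < N"
  then have "B l = (\<Sum>l'<N. scale (if l' = l then 1 else 0) (B l'))"
    by (simp add: if_distrib[of "\<lambda>c. scale c _"] cong: if_cong)
  then show "B l \<in> M" unfolding spanning by (intro image_eqI[where x = "\<lambda>l'. if l' = l then 1 else 0"]) auto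
qed

text \<open>The existence half of \<open>betti_eq\<close>. Exactness at \<open>F\<^sub>0\<close> is
  the independence of the basis, and minimality is immediate for zero maps.\<close>

lemma resolution:
  "minimal_graded_free_resolution M (\<lambda>j. if j = 0 then N else 0) (\<lambda>_. w)
     (\<lambda>x. \<Sum>l<N. scale (lookup x l) (B l)) (\<lambda>_ _. 0)"
proof (rule minimal_graded_free_resolution.intro)
  show "graded_elem (\<lambda>_. 0) v (\<Sum>l<N. scale (lookup x l) (B l))"
    if x: "graded_elem w v x" for x v
    unfolding graded_elem_iff lookup_sum lookup_scale
  proof (intro allI impI)
    fix k \<alpha>
    assume "(\<Sum>l<N. lookup (lookup x l * lookup (B l) k) \<alpha>) \<noteq> 0"
    then obtain l where l: "l < N" "lookup (lookup x l * lookup (B l) k) \<alpha> \<noteq> 0"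
      by (meson lessThan_iff sum.neutral)
    then obtain \<beta> \<gamma> where "\<alpha> = \<beta> + \<gamma>" "lookup (lookup x l) \<beta> \<noteq> 0" "lookup (lookup (B l) k) \<gamma> \<noteq> 0"
      by (blast elim: keys_mult_obtain)
    with x graded[OF l(1)] show "mdeg \<alpha> + 0 = v"
      by (auto simp: graded_elem_iff mdeg_add)
  qed
  show "(\<lambda>x. \<Sum>l<N. scale (lookup x l) (B l)) ` free_mod (if 0 = (0::nat) then N else 0) = M"
  proof
    show "M \<subseteq> (\<lambda>x. \<Sum>l<N. scale (lookup x l) (B l)) ` free_mod (if 0 = (0::nat) then N else 0)"
    proof
      fix y assume "y \<in> M"
      then obtain c where y: "y = (\<Sum>l<N. scale (c l) (B l))" by (auto simp: spanning)
      define x where "x = (\<Sum>l<N. single l (c l))"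
      have "lookup x l = c l" if "l < N" for l
        using that by (simp add: x_def lookup_sum lookup_single when_def)
      moreover have "x \<in> free_mod N"
        unfolding x_def by (intro free_mod_sum single_in_free_mod) auto
      ultimately show "y \<in> (\<lambda>x. \<Sum>l<N. scale (lookup x l) (B l)) ` free_mod (if 0 = (0::nat) then N else 0)"
        using y by (auto intro!: image_eqI[of _ _ x])
    qed
  qed (auto simp: spanning)
  show "(\<lambda>_ :: nat \<Rightarrow>\<^sub>0 'n cpoly. 0) ` free_mod (if 1 = (0::nat) then N else 0) =
    {x \<in> free_mod (if 0 = (0::nat) then N else 0). (\<Sum>l<N. scale (lookup x l) (B l)) = 0}"
  proof -
    have "x = 0" if "x \<in> free_mod N" "(\<Sum>l<N. scale (lookup x l) (B l)) = 0" for x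
    proof (rule poly_mapping_eqI)
      fix l show "lookup x l = lookup 0 l"
        using that independent[of "lookup x" l] by (cases "l < N") (auto simp: free_mod_iff)
    qed
    then show ?thesis by (auto simp: free_mod_0 zero_in_free_mod)
  qed
  show "module_hom scale scale (\<lambda>x. \<Sum>l<N. scale (lookup x l) (B l))"
    by unfold_locales
       (simp_all add: lookup_add lookup_scale scale.scale_left_distrib sum.distrib scale.scale_sum_right)
  show "module_hom scale scale (\<lambda>_ :: nat \<Rightarrow>\<^sub>0 'n cpoly. 0 :: nat \<Rightarrow>\<^sub>0 'n cpoly)"
    by unfold_locales simp_all
  show "(\<lambda>_ :: nat \<Rightarrow>\<^sub>0 'n cpoly. 0 :: nat \<Rightarrow>\<^sub>0 'n cpoly) ` free_mod (if Suc (Suc j) = (0::nat) then N else 0) =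
    {x \<in> free_mod (if Suc j = (0::nat) then N else 0). 0 = (0 :: nat \<Rightarrow>\<^sub>0 'n cpoly)}" for j
    by (simp add: free_mod_0)
qed (simp_all add: graded_elem_def irrelevant_ideal_def)

end

text \<open>The uniqueness half: an arbitrary minimal resolution is compared with the known
  basis.\<close>

locale resolution_of_free = graded_basis M N B w + minimal_graded_free_resolution M rk dg \<epsilon> d
  for M :: "('k \<Rightarrow>\<^sub>0 'n::finite cpoly) set" and N B w rk dg \<epsilon> d
begin

sublocale eps: module_hom scale scale \<epsilon> by (rule linear_\<epsilon>)

text \<open>Since \<open>M\<close> is free, \<open>\<epsilon>\<close> splits; the vectors
  \<open>y l\<close> are the values of a section on the basis. They are not chosen
  homogeneous.\<close>

lemma lift_basis: "\<exists>y. \<forall>l<N. y l \<in> free_mod (rk 0) \<and> \<epsilon> (y l) = B l"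
proof (rule choice, rule allI)
  fix l show "\<exists>y. l < N \<longrightarrow> y \<in> free_mod (rk 0) \<and> \<epsilon> y = B l"
    using basis_in[of l] by (fastforce simp flip: exact_M)
qed

definition "y = (SOME y. \<forall>l<N. y l \<in> free_mod (rk 0) \<and> \<epsilon> (y l) = B l)"

lemma y: "l < N \<Longrightarrow> y l \<in> free_mod (rk 0)" "l < N \<Longrightarrow> \<epsilon> (y l) = B l"
  using someI_ex[OF lift_basis, folded y_def] by auto

text \<open>Provides the matrix of \<open>\<epsilon>\<close> with respect to the basis of
  \<open>F\<^sub>0\<close> and the basis \<open>B\<close> of \<open>M\<close>.\<close>

lemma matrix_ex: "\<exists>A. \<forall>k<rk 0. \<epsilon> (single k 1) = (\<Sum>l<N. scale (A k l) (B l))"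
proof (rule choice, rule allI)
  fix k show "\<exists>c. k < rk 0 \<longrightarrow> \<epsilon> (single k 1) = (\<Sum>l<N. scale (c l) (B l))"
    using exact_M single_in_free_mod[of k "rk 0" 1] by (auto simp: spanning)
qed

definition "A = (SOME A. \<forall>k<rk 0. \<epsilon> (single k 1) = (\<Sum>l<N. scale (A k l) (B l)))"

lemma A: "k < rk 0 \<Longrightarrow> \<epsilon> (single k 1) = (\<Sum>l<N. scale (A k l) (B l))"
  using someI_ex[OF matrix_ex, folded A_def] by auto

lemma eps_eq:
  assumes "x \<in> free_mod (rk 0)"
  shows "\<epsilon> x = (\<Sum>l<N. scale (\<Sum>k<rk 0. lookup x k * A k l) (B l))"
proof -
  have "\<epsilon> x = \<epsilon> (\<Sum>k<rk 0. scale (lookup x k) (single k 1))"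
    using assms by (simp add: free_mod_expand)
  also have "\<dots> = (\<Sum>k<rk 0. scale (lookup x k) (\<Sum>l<N. scale (A k l) (B l)))"
    by (simp add: eps.sum eps.scale A)
  also have "\<dots> = (\<Sum>k<rk 0. \<Sum>l<N. scale (lookup x k * A k l) (B l))"
    by (simp add: scale.scale_sum_right)
  also have "\<dots> = (\<Sum>l<N. scale (\<Sum>k<rk 0. lookup x k * A k l) (B l))"
    by (subst sum.swap) (simp add: scale.scale_sum_left)
  finally show ?thesis .
qed

text \<open>
  The projection of \<open>F\<^sub>0\<close> onto the kernel \<open>K\<close> of \<open>\<epsilon>\<close> along the lifted basis shows that
  \<open>K \<subseteq> \<mm>\<^sup>j F\<^sub>0\<close> implies \<open>K = \<pi>(K) \<subseteq> \<mm>\<^sup>j K\<close>. This replaces Nakayama's lemma.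
\<close>

lemma kernel_order_ge:
  assumes "x \<in> free_mod (rk 0)" "\<epsilon> x = 0"
  shows "order_ge j (lookup x i)"
  using assms
proof (induction j arbitrary: x i)
  case 0
  show ?case by (simp add: order_ge_def)
next
  case (Suc j)
  \<comment> \<open>The image of the \<open>k\<close>-th basis vector under the projection onto the
    kernel.\<close>
  define p where "p k = single k 1 - (\<Sum>l<N. scale (A k l) (y l))" for k
  have p: "p k \<in> free_mod (rk 0)" "\<epsilon> (p k) = 0" if "k < rk 0" for k
    using that by (auto simp: p_def eps.diff eps.sum eps.scale A y
        intro!: free_mod_diff single_in_free_mod free_mod_sum free_mod_scale)
  \<comment> \<open>By exactness \<open>p k\<close> is in the image of \<open>d 0\<close>, so
    minimality puts its entries in the irrelevant ideal. Each round of the induction gains this one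
    order.\<close>
  have "order_ge 1 (lookup (p k) i)" if k: "k < rk 0" for k
  proof -
    from p[OF k] exact_0 obtain z where "z \<in> free_mod (rk 1)" "p k = d 0 z"
      by blast
    then show ?thesis using minimal[of z 0 i] by (simp add: irrelevant_iff_order_ge)
  qed
  then have *: "order_ge (Suc j) (\<Sum>k<rk 0. lookup x k * lookup (p k) i)"
    using order_ge_mult[OF Suc.IH[OF Suc.prems] \<open>_ \<Longrightarrow> order_ge 1 _\<close>]
    by (intro order_ge_sum) simp
  have "(\<Sum>k<rk 0. lookup x k * A k l) = 0" if "l < N" for l
    using independent[OF _ that] eps_eq[OF Suc.prems(1)] Suc.prems(2) by simp
  then have "(\<Sum>l<N. scale (\<Sum>k<rk 0. lookup x k * A k l) (y l)) = 0"
    by simp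
  then have "(\<Sum>k<rk 0. scale (lookup x k) (\<Sum>l<N. scale (A k l) (y l))) = 0"
    by (simp add: scale.scale_sum_right scale.scale_sum_left sum.swap[of _ "{..<N}"])
  then have "(\<Sum>k<rk 0. scale (lookup x k) (p k)) = x"
    using free_mod_expand[OF Suc.prems(1)]
    by (simp add: p_def scale.scale_right_diff_distrib sum_subtractf)
  then have "lookup x i = (\<Sum>k<rk 0. lookup x k * lookup (p k) i)"
    by (metis (no_types, lifting) lookup_scale lookup_sum sum.cong)
  with * show ?case by simp
qed

lemma kernel_trivial: "x \<in> free_mod (rk 0) \<Longrightarrow> \<epsilon> x = 0 \<Longrightarrow> x = 0"
  by (intro poly_mapping_eqI[of x 0]) (simp add: order_ge_imp_zero kernel_order_ge)

text \<open>A surjection onto a nonzero \<open>F\<^sub>j\<close> would reach a basis vector, whose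
  entry 1 has a nonzero constant term, against minimality.\<close>

lemma rk_eq_0_if_image_all:
  assumes "d j ` free_mod (rk (Suc j)) = free_mod (rk j)"
  shows "rk j = 0"
proof (rule ccontr)
  assume "rk j \<noteq> 0"
  then have "single 0 1 \<in> d j ` free_mod (rk (Suc j))"
    by (simp add: assms single_in_free_mod del: single_one)
  then obtain z where z: "z \<in> free_mod (rk (Suc j))" "single 0 1 = d j z" by blast
  from minimal[OF z(1), of 0] show False
    by (simp add: z(2)[symmetric] irrelevant_ideal_def)
qed

text \<open>A zero map out of \<open>F\<^sub>j\<close> makes the next map onto
  \<open>F\<^sub>j\<close> by exactness, so \<open>F\<^sub>j\<close> vanishes. For
  \<open>F\<^sub>1\<close> the map is zero because \<open>\<epsilon>\<close> has trivial kernel, for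
  the later modules because its target has already vanished.\<close>

lemma rk_Suc: "rk (Suc j) = 0"
proof (induction j)
  case 0
  have "d 0 ` free_mod (rk 1) = {0}"
    using exact_0 kernel_trivial by (auto simp: zero_in_free_mod)
  then have "d (Suc 0) ` free_mod (rk (Suc (Suc 0))) = free_mod (rk (Suc 0))"
    unfolding exact_Suc by auto
  then show ?case by (rule rk_eq_0_if_image_all)
next
  case (Suc j)
  have "d (Suc j) 0 = 0"
    by (rule module_hom.zero[OF linear_d])
  have "d (Suc j) x = 0" if "x \<in> free_mod (rk (Suc (Suc j)))" for x
  proof -
    have "d (Suc j) x \<in> free_mod (rk (Suc j))"
      using that exact_Suc[of j] by blast
    then show ?thesis by (simp add: Suc free_mod_0)
  qed
  then have "d (Suc (Suc j)) ` free_mod (rk (Suc (Suc (Suc j)))) = free_mod (rk (Suc (Suc j)))"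
    unfolding exact_Suc by auto
  then show ?case by (rule rk_eq_0_if_image_all)
qed

text \<open>With a trivial kernel the section is a two-sided inverse of \<open>\<epsilon>\<close>.
  Here and in \<open>y_times_A\<close> only the diagonal entries of the two matrix products are
  recorded, since these are what a trace sees.\<close>

lemma A_times_y:
  assumes k: "k < rk 0"
  shows "(\<Sum>l<N. A k l * lookup (y l) k) = 1"
proof -
  have "single k 1 - (\<Sum>l<N. scale (A k l) (y l)) = 0"
    using k by (intro kernel_trivial) (auto simp: eps.diff eps.sum eps.scale A y
        intro!: free_mod_diff single_in_free_mod free_mod_sum free_mod_scale)
  then have "lookup (\<Sum>l<N. scale (A k l) (y l)) k = lookup (single k 1) k"
    by simp
  then show ?thesis by (simp add: lookup_sum lookup_scale)
qed

lemma y_times_A: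
  assumes l: "l < N"
  shows "(\<Sum>k<rk 0. lookup (y l) k * A k l) = 1"
proof -
  have "(\<Sum>l'<N. scale (\<Sum>k<rk 0. lookup (y l) k * A k l') (B l')) =
        (\<Sum>l'<N. scale (if l' = l then 1 else 0) (B l'))"
    using eps_eq[OF y(1)[OF l]] y(2)[OF l] l
    by (simp add: if_distrib[of "\<lambda>c. scale c _"] cong: if_cong)
  from coords_unique[OF this l] show ?thesis by simp
qed

lemma A_graded: "k < rk 0 \<Longrightarrow> l < N \<Longrightarrow> lookup (A k l) 0 \<noteq> 0 \<Longrightarrow> w l = dg 0 k"
proof -
  assume k: "k < rk 0" and l: "l < N" and nz: "lookup (A k l) 0 \<noteq> 0"
  have "graded_elem (dg 0) (dg 0 k) (single k 1)"
    by (auto simp: graded_elem_def lookup_single split: if_splits)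
  from graded_\<epsilon>[OF single_in_free_mod[OF k] this]
  have "graded_elem (\<lambda>_. 0) (dg 0 k) (\<Sum>l<N. scale (A k l) (B l))"
    by (simp add: A[OF k])
  from coords_graded[OF this l nz] show "w l = dg 0 k" .
qed

text \<open>
  The constant terms of the two coordinate matrices are inverse to each other, and blockwise
  so with respect to the degrees; the ranks of the blocks agree by taking traces.
\<close>

lemma card_dg: "card {k. k < rk 0 \<and> dg 0 k = i} = card {l. l < N \<and> w l = i}"
proof -
  let ?K = "{k. k < rk 0 \<and> dg 0 k = i}" and ?L = "{l. l < N \<and> w l = i}"
  define a where "a k l = lookup (A k l) 0 * lookup (lookup (y l) k) 0" for k l
  \<comment> \<open>The factor from \<open>A\<close> alone makes \<open>a\<close> vanish off the
    blocks, so the lift \<open>y\<close> may be inhomogeneous.\<close>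
  have block: "w l = dg 0 k" if "a k l \<noteq> 0" "k < rk 0" "l < N" for k l
    using that A_graded[of k l] by (auto simp: a_def)
  have 1: "(\<Sum>l\<in>?L. a k l) = 1" if k: "k \<in> ?K" for k
  proof -
    have "(\<Sum>l\<in>?L. a k l) = (\<Sum>l<N. a k l)"
      using k by (intro sum.mono_neutral_left) (auto dest: block)
    also have "\<dots> = lookup (\<Sum>l<N. A k l * lookup (y l) k) 0"
      by (simp add: lookup_sum lookup_mult_0 a_def)
    finally show ?thesis using k by (simp add: A_times_y)
  qed
  have 2: "(\<Sum>k\<in>?K. a k l) = 1" if l: "l \<in> ?L" for l
  proof -
    have "(\<Sum>k\<in>?K. a k l) = (\<Sum>k<rk 0. a k l)"
      using l by (intro sum.mono_neutral_left) (auto dest: block)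
    also have "\<dots> = lookup (\<Sum>k<rk 0. lookup (y l) k * A k l) 0"
      by (simp add: lookup_sum lookup_mult_0 a_def mult.commute)
    finally show ?thesis using l by (simp add: y_times_A)
  qed
  have "of_nat (card ?K) = (\<Sum>k\<in>?K. \<Sum>l\<in>?L. a k l)"
    by (simp add: 1)
  also have "\<dots> = (\<Sum>l\<in>?L. \<Sum>k\<in>?K. a k l)"
    by (rule sum.swap)
  also have "\<dots> = of_nat (card ?L)"
    by (simp add: 2)
  finally show ?thesis by (simp only: of_nat_eq_iff)
qed

end

lemma (in graded_basis) betti_eq:
  "betti M j i = (if j = 0 then card {l. l < N \<and> w l = i} else 0)"
  unfolding betti_def
proof (rule the_equality)
  show "\<exists>rk dg \<epsilon> d. minimal_graded_free_resolution M rk dg \<epsilon> d \<and>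
     (if j = 0 then card {l. l < N \<and> w l = i} else 0) = card {k. k < rk j \<and> dg j k = i}"
    using resolution by fastforce
next
  fix c
  assume "\<exists>rk dg \<epsilon> d. minimal_graded_free_resolution M rk dg \<epsilon> d \<and> c = card {k. k < rk j \<and> dg j k = i}"
  then obtain rk dg \<epsilon> d where res: "minimal_graded_free_resolution M rk dg \<epsilon> d"
    and c: "c = card {k. k < rk j \<and> dg j k = i}" by blast
  interpret resolution_of_free M N B w rk dg \<epsilon> d
    using res by (intro resolution_of_free.intro graded_basis_axioms)
  show "c = (if j = 0 then card {l. l < N \<and> w l = i} else 0)"
    using c card_dg rk_Suc by (cases j) auto
qed

section \<open>Derivatives of polynomials\<close>

text \<open>Keeps the unit exponents in the form \<open>single j 1\<close>, on which the following
  lemmas match.\<close>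

declare One_nat_def [simp del]

abbreviation (input) const :: "'b \<Rightarrow> ('a::zero \<Rightarrow>\<^sub>0 'b::zero)" where "const \<equiv> Poly_Mapping.single 0"

lemma sum_single: "(\<Sum>\<alpha>\<in>keys f. single \<alpha> (lookup f \<alpha>)) = f"
  by (rule poly_mapping_eqI) (auto simp: lookup_sum lookup_single when_def in_keys_iff)

lemma poly_mapping_single_induct [case_names single add]:
  fixes f :: "'a \<Rightarrow>\<^sub>0 'b::comm_monoid_add"
  assumes single: "\<And>a c. P (single a c)" and add: "\<And>f g. P f \<Longrightarrow> P g \<Longrightarrow> P (f + g)"
  shows "P f"
proof -
  have "P (\<Sum>a\<in>A. single a (lookup f a))" if "finite A" for A
    \<comment> \<open>\<open>single undefined 0\<close> is 0, which settles the empty sum.\<close>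
    using that by (induction) (use single[of undefined 0] in \<open>auto intro: single add\<close>)
  then show ?thesis by (metis sum_single finite_keys)
qed

lemma ex_lookup_nonzero:
  assumes "\<alpha> \<noteq> 0"
  obtains j where "lookup \<alpha> j \<noteq> 0"
  using assms poly_mapping_eqI[of \<alpha> 0] by auto

lemma monomial_induct [case_names 0 add]:
  fixes \<alpha> :: "'n::finite \<Rightarrow>\<^sub>0 nat"
  assumes "P 0" "\<And>\<alpha> j. P \<alpha> \<Longrightarrow> P (\<alpha> + single j 1)"
  shows "P \<alpha>"
proof (induction "mdeg \<alpha>" arbitrary: \<alpha>)
  case 0
  then show ?case using assms(1) by (simp add: mdeg_eq_0_iff)
next
  case (Suc m)
  then have "\<alpha> \<noteq> 0" by auto
  then obtain j where j: "lookup \<alpha> j \<noteq> 0" by (rule ex_lookup_nonzero)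
  have "\<alpha> = \<alpha> - single j 1 + single j 1"
    using j by (intro poly_mapping_eqI) (auto simp: lookup_add lookup_minus lookup_single when_def)
  moreover from this have "mdeg \<alpha> = mdeg (\<alpha> - single j 1) + mdeg (single j 1)"
    by (metis mdeg_add)
  moreover have "mdeg (single j (1::nat)) = 1"
    by (simp add: mdeg_def lookup_single when_def)
  ultimately show ?case using Suc assms(2) by (metis Suc_eq_plus1 Suc_inject)
qed

lemma mdeg_single [simp]: "mdeg (single j a) = a"
  by (simp add: mdeg_def lookup_single when_def)

lemma monomial_minus_plus:
  fixes \<alpha> :: "'n \<Rightarrow>\<^sub>0 nat"
  assumes "lookup \<alpha> j \<noteq> 0"
  shows "\<alpha> - single j 1 + \<beta> = \<alpha> + \<beta> - single j 1"
  using assms by (intro poly_mapping_eqI) (auto simp: lookup_add lookup_minus lookup_single when_def)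

lemma partial_deriv_add: "partial_deriv i (f + g) = partial_deriv i f + partial_deriv i g"
  by (rule poly_mapping_eqI) (simp add: lookup_partial_deriv lookup_add algebra_simps)

lemma partial_deriv_single:
  "partial_deriv i (single \<alpha> c) = single (\<alpha> - single i 1) (of_nat (lookup \<alpha> i) * c)"
  by (simp add: partial_deriv_def)

lemma partial_deriv_mult:
  "partial_deriv i (f * g) = partial_deriv i f * g + f * partial_deriv i g"
proof (induction f rule: poly_mapping_single_induct)
  case (single \<alpha> a)
  show ?case
  proof (induction g rule: poly_mapping_single_induct)
    case (single \<beta> b)
    \<comment> \<open>Where \<open>\<alpha>\<close> does not contain \<open>i\<close>, truncated
      subtraction makes the exponents differ, but the coefficient is then 0. The same applies to
      \<open>\<beta>\<close> below.\<close>
    have 1: "single (\<alpha> + \<beta> - single i 1) (of_nat (lookup \<alpha> i) * (a * b)) =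
          single (\<alpha> - single i 1 + \<beta>) (of_nat (lookup \<alpha> i) * (a * b))"
      by (cases "lookup \<alpha> i = 0") (simp_all add: monomial_minus_plus)
    have 2: "single (\<alpha> + \<beta> - single i 1) (of_nat (lookup \<beta> i) * (a * b)) =
          single (\<alpha> + (\<beta> - single i 1)) (of_nat (lookup \<beta> i) * (a * b))"
      using monomial_minus_plus[of \<beta> i \<alpha>]
      by (cases "lookup \<beta> i = 0") (simp_all add: add.commute)
    have "partial_deriv i (single \<alpha> a * single \<beta> b) =
      single (\<alpha> + \<beta> - single i 1) (of_nat (lookup \<alpha> i) * (a * b)) +
      single (\<alpha> + \<beta> - single i 1) (of_nat (lookup \<beta> i) * (a * b))"
      by (simp add: mult_single partial_deriv_single lookup_add algebra_simps flip: single_add)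
    then show ?case unfolding 1 2
      by (simp add: partial_deriv_single mult_single mult_ac add_ac)
  qed (simp add: partial_deriv_add algebra_simps)
qed (simp add: partial_deriv_add algebra_simps)

lemma partial_deriv_const: "partial_deriv i (const c) = 0"
  by (simp add: partial_deriv_single)

lemma partial_deriv_const_mult: "partial_deriv i (const c * f) = const c * partial_deriv i f"
  by (simp add: partial_deriv_mult partial_deriv_const)

lemma multi_deriv_0: "multi_deriv 0 f = f"
proof -
  interpret comp_fun_commute "\<lambda>(_ :: 'a) (g :: 'a cpoly). g"
    by unfold_locales (simp add: fun_eq_iff)
  have "Finite_Set.fold (\<lambda>_ g. g) f A = f" if "finite A" for A :: "'a set"
    using that by induction simp_all
  moreover have "(\<lambda>i :: 'a. partial_deriv i ^^ lookup 0 i) = (\<lambda>_ g. g)"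
    by (simp add: fun_eq_iff)
  ultimately show ?thesis by (simp add: multi_deriv_def)
qed

text \<open>Together with \<open>multi_deriv_0\<close> this replaces the fold by a recursion on the
  exponent. The two folds agree away from \<open>j\<close>, and commutation allows \<open>j\<close>
  to be taken out of both.\<close>

lemma multi_deriv_plus_single:
  "multi_deriv (\<alpha> + single j 1) f = multi_deriv \<alpha> (partial_deriv j f)"
proof -
  define g h where "g = (\<lambda>i. partial_deriv i ^^ lookup \<alpha> i)"
    and "h = (\<lambda>i. partial_deriv i ^^ lookup (\<alpha> + single j 1) i)"
  interpret g: comp_fun_commute g
    unfolding g_def by (rule comp_fun_commute_partial_deriv)
  interpret h: comp_fun_commute h
    unfolding h_def by (rule comp_fun_commute_partial_deriv)
  have U: "UNIV = insert j (UNIV - {j})" by auto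
  have h: "h i = g i" if "i \<noteq> j" for i
    using that by (simp add: g_def h_def lookup_add lookup_single)
  have "Finite_Set.fold h x A = Finite_Set.fold g x A" if "finite A" "j \<notin> A" for A x
    using that by induction (auto simp: h)
  then have "Finite_Set.fold h f UNIV = Finite_Set.fold g (h j f) (UNIV - {j})"
    by (subst U, subst h.fold_insert2) auto
  also have "h j f = g j (partial_deriv j f)"
    by (simp add: g_def h_def lookup_add One_nat_def funpow_swap1)
  also have "Finite_Set.fold g (g j (partial_deriv j f)) (UNIV - {j}) =
             Finite_Set.fold g (partial_deriv j f) UNIV"
    by (subst (2) U, subst g.fold_insert2) auto
  finally show ?thesis by (simp add: multi_deriv_def g_def h_def)
qed

lemma multi_deriv_add: "multi_deriv \<alpha> (f + g) = multi_deriv \<alpha> f + multi_deriv \<alpha> g"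
  by (induction \<alpha> arbitrary: f g rule: monomial_induct)
     (simp_all only: multi_deriv_0 multi_deriv_plus_single partial_deriv_add)

lemma multi_deriv_const_mult: "multi_deriv \<alpha> (const c * f) = const c * multi_deriv \<alpha> f"
  by (induction \<alpha> arbitrary: f rule: monomial_induct)
     (simp_all only: multi_deriv_0 multi_deriv_plus_single partial_deriv_const_mult)

section \<open>Differential operators\<close>

lemma op_apply_superset:
  "finite A \<Longrightarrow> keys \<delta> \<subseteq> A \<Longrightarrow> op_apply \<delta> v = (\<Sum>\<alpha>\<in>A. lookup \<delta> \<alpha> * multi_deriv \<alpha> v)"
  unfolding op_apply_def by (rule sum.mono_neutral_left) (auto simp: in_keys_iff)

lemma op_apply_add: "op_apply (\<delta> + \<eta>) v = op_apply \<delta> v + op_apply \<eta> v"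
  using keys_add[of \<delta> \<eta>]
  by (simp add: op_apply_superset[of "keys \<delta> \<union> keys \<eta>"] lookup_add algebra_simps sum.distrib)

lemma op_apply_0 [simp]: "op_apply 0 v = 0"
  by (simp add: op_apply_def)

lemma op_apply_sum: "op_apply (sum F A) v = (\<Sum>a\<in>A. op_apply (F a) v)"
  by (induction A rule: infinite_finite_induct) (simp_all add: op_apply_add)

lemma op_apply_single: "op_apply (single \<alpha> s) v = s * multi_deriv \<alpha> v"
  by (subst op_apply_superset[of "{\<alpha>}"]) auto

lemma op_apply_scale: "op_apply (scale s \<delta>) v = s * op_apply \<delta> v"
  by (subst op_apply_superset[of "keys \<delta>"])
     (auto simp: lookup_scale in_keys_iff op_apply_def sum_distrib_left mult.assoc)

lemma op_apply_add_right: "op_apply \<delta> (f + g) = op_apply \<delta> f + op_apply \<delta> g"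
  by (simp add: op_apply_def multi_deriv_add algebra_simps sum.distrib)

lemma op_apply_const_mult_right: "op_apply \<delta> (const c * f) = const c * op_apply \<delta> f"
  by (simp add: op_apply_def multi_deriv_const_mult sum_distrib_left mult.left_commute)

lemma op_apply_0_right [simp]: "op_apply \<delta> 0 = 0"
  using op_apply_const_mult_right[of \<delta> 0 0] by simp

lemma op_apply_sum_right: "op_apply \<delta> (sum F A) = (\<Sum>a\<in>A. op_apply \<delta> (F a))"
  by (induction A rule: infinite_finite_induct) (simp_all add: op_apply_add_right)

lemma op_apply_1: "op_apply 1 v = v"
  using op_apply_single[of 0 1 v] by (simp add: multi_deriv_0)

text \<open>
  On operators, the convolution product with constant coefficient operators on the right is
  composition.
\<close>

lemma op_apply_mult_single:
  "op_apply (\<delta> * single (single j 1) (const c)) f = op_apply \<delta> (const c * partial_deriv j f)"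
  by (induction \<delta> rule: poly_mapping_single_induct)
     (simp_all only: mult_single op_apply_single multi_deriv_plus_single multi_deriv_const_mult
       op_apply_add distrib_right mult.assoc)

lemma scale_eq_mult: "scale s x = const s * x"
  unfolding scale_def by (rule mult_map_scale_conv_mult)

text \<open>In characteristic 0 a positive integer is a unit of the polynomial ring. With
  \<open>g = 0\<close> this also cancels the integer from an equation.\<close>

lemma of_nat_Suc_cancel:
  fixes f g :: "'n cpoly"
  assumes "g dvd of_nat (Suc k) * f"
  shows "g dvd f"
proof -
  have "const (inverse (of_nat (Suc k))) * of_nat (Suc k) = (1 :: 'n cpoly)"
    unfolding single_of_nat[symmetric] mult_single
    by (simp only: left_inverse[OF of_nat_neq_0] add_0 single_one)
  then have *: "const (inverse (of_nat (Suc k))) * (of_nat (Suc k) * f) = f"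
    by (simp only: mult.assoc[symmetric] mult_1)
  show ?thesis
    using dvd_mult[OF assms, of "const (inverse (of_nat (Suc k)))"] unfolding * .
qed

section \<open>Homogeneous polynomials and operators with constant coefficients\<close>

lemma homogeneous_mult: "homogeneous v f \<Longrightarrow> homogeneous w g \<Longrightarrow> homogeneous (v + w) (f * g)"
  unfolding homogeneous_def using keys_mult[of f g] by (fastforce simp: mdeg_add)

lemma homogeneous_add: "homogeneous v f \<Longrightarrow> homogeneous v g \<Longrightarrow> homogeneous v (f + g)"
  unfolding homogeneous_def using keys_add[of f g] by blast

lemma homogeneous_0 [simp]: "homogeneous v 0"
  by (simp add: homogeneous_def)

lemma homogeneous_sum: "(\<And>a. a \<in> A \<Longrightarrow> homogeneous v (F a)) \<Longrightarrow> homogeneous v (sum F A)"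
  by (induction A rule: infinite_finite_induct) (simp_all add: homogeneous_add)

lemma homogeneous_single: "mdeg \<alpha> = v \<Longrightarrow> homogeneous v (single \<alpha> c)"
  by (simp add: homogeneous_def)

text \<open>A polynomial that is \<open>homogeneous 0\<close> is a constant, possibly 0.\<close>

definition const_op :: "nat \<Rightarrow> 'n::finite diff_op \<Rightarrow> bool" where
  "const_op m \<delta> \<longleftrightarrow> (\<forall>\<alpha>. (lookup \<delta> \<alpha> \<noteq> 0 \<longrightarrow> mdeg \<alpha> = m) \<and> homogeneous 0 (lookup \<delta> \<alpha>))"

lemma const_op_add: "const_op m \<delta> \<Longrightarrow> const_op m \<eta> \<Longrightarrow> const_op m (\<delta> + \<eta>)"
  unfolding const_op_def lookup_add by (metis add_0 homogeneous_add)

lemma const_op_0: "const_op m 0"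
  by (simp add: const_op_def)

lemma const_op_sum: "(\<And>a. a \<in> A \<Longrightarrow> const_op m (F a)) \<Longrightarrow> const_op m (sum F A)"
  by (induction A rule: infinite_finite_induct) (simp_all add: const_op_add const_op_0)

lemma const_op_single: "mdeg \<alpha> = m \<Longrightarrow> homogeneous 0 s \<Longrightarrow> const_op m (single \<alpha> s)"
  by (auto simp: const_op_def lookup_single when_def)

lemma const_op_mult:
  assumes "const_op m \<delta>" "const_op l \<eta>"
  shows "const_op (m + l) (\<delta> * \<eta>)"
proof -
  have "\<delta> * \<eta> = (\<Sum>\<alpha>\<in>keys \<delta>. \<Sum>\<beta>\<in>keys \<eta>. single (\<alpha> + \<beta>) (lookup \<delta> \<alpha> * lookup \<eta> \<beta>))"
    by (subst (1) sum_single[of \<delta>, symmetric], subst (1) sum_single[of \<eta>, symmetric])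
       (simp add: sum_product mult_single)
  moreover have "const_op (m + l) (single (\<alpha> + \<beta>) (lookup \<delta> \<alpha> * lookup \<eta> \<beta>))"
    if "\<alpha> \<in> keys \<delta>" "\<beta> \<in> keys \<eta>" for \<alpha> \<beta>
    using that assms
    by (intro const_op_single homogeneous_mult[of 0 _ 0, simplified])
       (auto simp: const_op_def mdeg_add in_keys_iff)
  ultimately show ?thesis by (simp add: const_op_sum)
qed

definition monomials :: "nat \<Rightarrow> ('n::finite \<Rightarrow>\<^sub>0 nat) set" where
  "monomials m = {\<alpha>. mdeg \<alpha> = m}"

lemma finite_monomials: "finite (monomials m :: ('n::finite \<Rightarrow>\<^sub>0 nat) set)"
proof (rule finite_subset)
  show "monomials m \<subseteq> Poly_Mapping.Abs_poly_mapping ` (PiE UNIV (\<lambda>_::'n. {..m}))"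
  proof
    fix \<alpha> :: "'n \<Rightarrow>\<^sub>0 nat" assume "\<alpha> \<in> monomials m"
    then have "lookup \<alpha> i \<le> m" for i
      unfolding monomials_def mdeg_def by (auto intro!: member_le_sum)
    then show "\<alpha> \<in> Poly_Mapping.Abs_poly_mapping ` (PiE UNIV (\<lambda>_::'n. {..m}))"
      by (intro image_eqI[of _ _ "lookup \<alpha>"]) (auto simp: lookup_inverse)
  qed
qed (auto intro!: finite_PiE)

text \<open>Coefficients are indexed by \<open>A\<close> and not by the image: a new generator
  \<open>f a\<close> raises the coefficient of one chosen preimage, so \<open>f\<close> may identify
  indices.\<close>

lemma (in module) span_image_finite:
  assumes "finite A" "x \<in> span (f ` A)"
  shows "\<exists>c. x = (\<Sum>a\<in>A. scale (c a) (f a))"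
  using assms(2)
proof (induction rule: span_induct_alt)
  case base
  show ?case by (intro exI[of _ "\<lambda>_. 0"]) simp
next
  case (step r z y)
  then obtain a c where a: "a \<in> A" "z = f a" and c: "y = (\<Sum>a\<in>A. scale (c a) (f a))" by blast
  have "scale r z + y = (\<Sum>b\<in>A. scale ((if b = a then r else 0) + c b) (f b))"
    using a assms(1)
    by (simp add: c scale_left_distrib sum.distrib if_distrib[of "\<lambda>c. scale c _"] cong: if_cong)
  then show ?case by (intro exI[of _ "\<lambda>b. (if b = a then r else 0) + c b"])
qed

section \<open>Operators in linear coordinates\<close>

text \<open>
  \<open>D i\<close> is the derivation with constant coefficients dual to the linear form \<open>y i\<close>, and \<open>Th i\<close>
  is the same derivation as an element of the convolution ring of operators.
\<close>

locale linear_coords =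
  fixes Y P :: "'n::finite \<Rightarrow> 'n \<Rightarrow> complex"
  assumes YP: "\<And>i k. (\<Sum>j\<in>UNIV. Y i j * P j k) = (if i = k then 1 else 0)"
    and PY: "\<And>i k. (\<Sum>j\<in>UNIV. P i j * Y j k) = (if i = k then 1 else 0)"
begin

definition y :: "'n \<Rightarrow> 'n cpoly" where
  "y i = (\<Sum>j\<in>UNIV. single (single j 1) (Y i j))"

definition D :: "'n \<Rightarrow> 'n cpoly \<Rightarrow> 'n cpoly" where
  "D i f = (\<Sum>j\<in>UNIV. const (P j i) * partial_deriv j f)"

definition Th :: "'n \<Rightarrow> 'n diff_op" where
  "Th i = (\<Sum>j\<in>UNIV. single (single j 1) (const (P j i)))"

definition Theta :: "('n \<Rightarrow>\<^sub>0 nat) \<Rightarrow> 'n diff_op" where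
  "Theta \<alpha> = (\<Prod>i\<in>UNIV. Th i ^ lookup \<alpha> i)"

lemma homogeneous_y: "homogeneous 1 (y i)"
  unfolding y_def by (intro homogeneous_sum homogeneous_single) simp

lemma D_add: "D i (f + g) = D i f + D i g"
  by (simp add: D_def partial_deriv_add algebra_simps sum.distrib)

lemma D_mult: "D i (f * g) = D i f * g + f * D i g"
  by (simp add: D_def partial_deriv_mult algebra_simps sum.distrib sum_distrib_left sum_distrib_right)

lemma partial_deriv_y: "partial_deriv j (y i) = const (Y i j)"
proof -
  have sum: "partial_deriv j (sum F A) = (\<Sum>a\<in>A. partial_deriv j (F a))" for F :: "'n \<Rightarrow> 'n cpoly" and A
    by (induction A rule: infinite_finite_induct)
       (use partial_deriv_const[of j 0] in \<open>simp_all add: partial_deriv_add\<close>)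
  have "partial_deriv j (y i) = (\<Sum>k\<in>UNIV. if k = j then const (Y i j) else 0)"
    unfolding y_def sum
    by (intro sum.cong) (auto simp: partial_deriv_single lookup_single when_def)
  then show ?thesis by simp
qed

lemma D_y: "D i (y k) = (if i = k then 1 else 0)"
proof -
  have "D i (y k) = const (\<Sum>j\<in>UNIV. Y k j * P j i)"
    unfolding D_def partial_deriv_y mult_single
    by (rule poly_mapping_eqI) (simp add: lookup_sum lookup_single when_def mult.commute)
  then show ?thesis by (auto simp: YP)
qed

lemma D_0 [simp]: "D i 0 = 0"
  using D_add[of i 0 0] by simp

lemma D_of_nat [simp]: "D i (of_nat k) = 0"
proof (induction k)
  case (Suc k)
  then show ?case using D_mult[of i 1 1] by (simp add: D_add)
qed simp

text \<open>Every monomial of \<open>D i f\<close> has degree one less than some monomial of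
  \<open>f\<close>, so the iteration stops once it exceeds the degree. This gives the starting point
  of the descent in \<open>dvd_D_cancel\<close>.\<close>

lemma D_nilpotent: "\<exists>K. (D i ^^ K) f = 0"
proof -
  have *: "\<forall>\<alpha>\<in>keys f. mdeg \<alpha> < K \<Longrightarrow> (D i ^^ K) f = 0" for K f
  proof (induction K arbitrary: f)
    case 0
    then show ?case by (simp flip: keys_eq_empty)
  next
    case (Suc K)
    have "mdeg \<alpha> < K" if \<alpha>: "\<alpha> \<in> keys (D i f)" for \<alpha>
    proof -
      from \<alpha> obtain j where "lookup (const (P j i) * partial_deriv j f) \<alpha> \<noteq> 0"
        unfolding D_def in_keys_iff lookup_sum by (meson sum.neutral)
      then obtain \<beta> \<gamma> where "\<alpha> = \<beta> + \<gamma>" "lookup (const (P j i)) \<beta> \<noteq> 0" "lookup (partial_deriv j f) \<gamma> \<noteq> 0"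
        by (rule keys_mult_obtain)
      then have "lookup f (\<alpha> + single j 1) \<noteq> 0"
        by (auto simp: lookup_single lookup_partial_deriv when_def split: if_splits)
      then show ?thesis using bspec[OF Suc.prems, of "\<alpha> + single j 1"]
        by (simp add: in_keys_iff mdeg_add)
    qed
    then show ?case using Suc.IH[of "D i f"] by (simp add: funpow_swap1)
  qed
  show ?thesis
    by (rule exI[of _ "Suc (Max (insert 0 (mdeg ` keys f)))"], rule *) (auto simp: less_Suc_eq_le)
qed

lemma Theta_0 [simp]: "Theta 0 = 1"
  by (simp add: Theta_def)

lemma Theta_plus_single: "Theta (\<alpha> + single i 1) = Theta \<alpha> * Th i"
proof -
  have "Theta (\<alpha> + single i 1) = Theta \<alpha> * (\<Prod>k\<in>UNIV. if k = i then Th k else 1)"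
    unfolding Theta_def prod.distrib[symmetric]
    by (intro prod.cong) (auto simp: lookup_add lookup_single when_def power_add)
  then show ?thesis by simp
qed

lemma op_apply_mult_Th: "op_apply (\<delta> * Th i) f = op_apply \<delta> (D i f)"
  by (simp add: Th_def D_def sum_distrib_left op_apply_sum op_apply_sum_right op_apply_mult_single)

abbreviation T :: "('n \<Rightarrow>\<^sub>0 nat) \<Rightarrow> 'n cpoly \<Rightarrow> 'n cpoly" where
  "T \<alpha> f \<equiv> op_apply (Theta \<alpha>) f"

lemma T_plus_single: "T (\<alpha> + single i 1) f = T \<alpha> (D i f)"
  by (simp only: Theta_plus_single op_apply_mult_Th)

text \<open>The Leibniz rule for the monomial in the \<open>D i\<close>: by duality only the factors
  \<open>D j\<close> see \<open>y j\<close>, each leaving a monomial with one \<open>D j\<close>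
  fewer. If there is none, the truncated exponent is multiplied by 0.\<close>

lemma T_y_mult: "T \<alpha> (y j * f) = y j * T \<alpha> f + of_nat (lookup \<alpha> j) * T (\<alpha> - single j 1) f"
proof (induction \<alpha> arbitrary: f rule: monomial_induct)
  case 0
  then show ?case by (simp add: op_apply_1)
next
  case (add \<alpha> i)
  have *: "T (\<alpha> + single i 1) (y j * f) = T \<alpha> (if i = j then f else 0) + T \<alpha> (y j * D i f)"
    by (simp only: T_plus_single D_mult D_y op_apply_add_right) auto
  have **: "of_nat (lookup \<alpha> j) * T (\<alpha> - single j 1) (D i f) =
            of_nat (lookup \<alpha> j) * T (\<alpha> + single i 1 - single j 1) f"
    by (cases "lookup \<alpha> j = 0")
       (simp_all only: T_plus_single[symmetric] monomial_minus_plus of_nat_0 mult_zero_left not_False_eq_True)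
  have "T (\<alpha> + single i 1) (y j * f) = T \<alpha> (if i = j then f else 0) +
      (y j * T (\<alpha> + single i 1) f + of_nat (lookup \<alpha> j) * T (\<alpha> + single i 1 - single j 1) f)"
    unfolding * add.IH ** by (simp only: T_plus_single)
  then show ?case
    by (cases "i = j") (simp_all add: lookup_add lookup_single distrib_right add_ac)
qed

text \<open>Applying \<open>D j\<close> repeatedly to \<open>d * y j\<close> stays within the
  multiples of \<open>g\<close> and yields
  \<open>D\<^sup>k\<^sup>+\<^sup>1 d * y j + (k + 1) D\<^sup>k d\<close>. So if \<open>g\<close>
  divides a derivative of \<open>d\<close>, it divides the previous one, and the descent starts at a
  derivative that is 0. With \<open>g\<close> another coordinate this replaces primality; with
  \<open>g = 0\<close> it shows that \<open>y j\<close> is not a zero divisor.\<close>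

lemma dvd_D_cancel:
  assumes closed: "\<And>f. g dvd f \<Longrightarrow> g dvd D j f" and "g dvd d * y j"
  shows "g dvd d"
proof -
  \<comment> \<open>At \<open>k = 0\<close> the truncated \<open>k - 1\<close> is harmless because
    of the factor \<open>of_nat k\<close>.\<close>
  have 1: "(D j ^^ k) (d * y j) = (D j ^^ k) d * y j + of_nat k * (D j ^^ (k - 1)) d" for k
  proof (induction k)
    case (Suc k)
    have "of_nat k * D j ((D j ^^ (k - 1)) d) = of_nat k * (D j ^^ k) d"
      by (cases k) simp_all
    with Suc show ?case
      by (simp add: D_add D_mult D_y algebra_simps)
  qed simp
  have 2: "g dvd (D j ^^ k) (d * y j)" for k
    by (induction k) (simp_all add: assms)
  have 3: "g dvd (D j ^^ k) d" if "g dvd (D j ^^ Suc k) d" for k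
  proof -
    have "g dvd (D j ^^ Suc k) d * y j + of_nat (Suc k) * (D j ^^ k) d"
      using 1[of "Suc k"] 2[of "Suc k"] by (simp del: of_nat_Suc)
    then have "g dvd of_nat (Suc k) * (D j ^^ k) d"
      by (simp only: dvd_add_right_iff[OF dvd_mult2[OF that]])
    then show ?thesis by (rule of_nat_Suc_cancel)
  qed
  obtain K where K: "(D j ^^ K) d = 0" using D_nilpotent by blast
  have "g dvd (D j ^^ (K - k)) d" if "k \<le> K" for k
    using that
  proof (induction k)
    case (Suc k)
    then show ?case using 3[of "K - Suc k"] by (simp add: Suc_diff_Suc)
  qed (simp add: K)
  from this[of K] show ?thesis by simp
qed

lemma dvd_D_cancel_prod:
  assumes "finite J" "\<And>j f. j \<in> J \<Longrightarrow> g dvd f \<Longrightarrow> g dvd D j f" "g dvd d * (\<Prod>j\<in>J. y j)"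
  shows "g dvd d"
  using assms
proof (induction J arbitrary: d)
  case (insert j J)
  have "g dvd (d * y j) * (\<Prod>j\<in>J. y j)"
    using insert.prems(2) insert.hyps by (simp add: mult_ac)
  with insert.IH insert.prems(1) have "g dvd d * y j" by blast
  with insert.prems(1) show ?case by (blast intro: dvd_D_cancel)
qed simp

lemma y_dvd_D: "i \<noteq> j \<Longrightarrow> y i dvd f \<Longrightarrow> y i dvd D j f"
  by (auto simp: D_mult D_y elim!: dvdE)

lemma y_dvd_cancel: "i \<notin> J \<Longrightarrow> y i dvd d * (\<Prod>j\<in>J. y j) \<Longrightarrow> y i dvd d"
  by (rule dvd_D_cancel_prod[of J]) (auto intro: y_dvd_D)

text \<open>Divisibility by 0 means being 0, and every \<open>D j\<close> preserves 0.\<close>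

lemma prod_y_cancel: "d * (\<Prod>j\<in>J. y j) = 0 \<Longrightarrow> d = 0"
  using dvd_D_cancel_prod[of J 0 d] by auto

lemma prod_y_dvd: "(\<And>j. j \<in> J \<Longrightarrow> y j dvd c) \<Longrightarrow> (\<Prod>j\<in>J. y j) dvd c"
proof (induction J rule: infinite_finite_induct)
  case (insert i J)
  then have "(\<Prod>j\<in>J. y j) dvd c" by blast
  then obtain e where e: "c = (\<Prod>j\<in>J. y j) * e" by (rule dvdE)
  have "y i dvd e * (\<Prod>j\<in>J. y j)"
    using insert.prems[of i] by (simp add: e mult.commute)
  then have "y i dvd e" using insert.hyps y_dvd_cancel by blast
  then show ?case using insert.hyps by (simp add: e mult.commute mult_dvd_mono)
qed auto

section \<open>Operators of order m in terms of their coefficients on the Theta monomials\<close>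

definition L :: "nat \<Rightarrow> (('n \<Rightarrow>\<^sub>0 nat) \<Rightarrow> 'n cpoly) \<Rightarrow> 'n cpoly \<Rightarrow> 'n cpoly" where
  "L m c f = (\<Sum>\<alpha>\<in>monomials m. c \<alpha> * T \<alpha> f)"

lemma L_0: "L 0 c f = c 0 * f"
proof -
  have "monomials 0 = {0 :: 'n \<Rightarrow>\<^sub>0 nat}" by (auto simp: monomials_def mdeg_eq_0_iff)
  then show ?thesis by (simp add: L_def op_apply_1)
qed

lemma L_eq_op_apply: "L m c f = op_apply (\<Sum>\<alpha>\<in>monomials m. scale (c \<alpha>) (Theta \<alpha>)) f"
  by (simp add: L_def op_apply_sum op_apply_scale)

text \<open>Summing \<open>T_y_mult\<close> and reindexing by
  \<open>\<alpha> = \<beta> + single j 1\<close>; the exponents without \<open>j\<close> contribute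
  0. The commutator with \<open>y j\<close> thus has order one less, and up to positive integers its
  coefficients are those of the operator at shifted exponents.\<close>

lemma L_commutator:
  "L (Suc m) c (y j * f) =
     y j * L (Suc m) c f + L m (\<lambda>\<beta>. of_nat (Suc (lookup \<beta> j)) * c (\<beta> + single j 1)) f"
proof -
  let ?F = "\<lambda>\<alpha>. of_nat (lookup \<alpha> j) * c \<alpha> * T (\<alpha> - single j 1) f"
  have "(\<Sum>\<alpha>\<in>monomials (Suc m). ?F \<alpha>) = (\<Sum>\<alpha>\<in>(\<lambda>\<beta>. \<beta> + single j 1) ` monomials m. ?F \<alpha>)"
  proof (rule sum.mono_neutral_right)
    show "\<forall>\<alpha>\<in>monomials (Suc m) - (\<lambda>\<beta>. \<beta> + single j 1) ` monomials m. ?F \<alpha> = 0"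
    proof
      fix \<alpha> :: "'n \<Rightarrow>\<^sub>0 nat"
      assume \<alpha>: "\<alpha> \<in> monomials (Suc m) - (\<lambda>\<beta>. \<beta> + single j 1) ` monomials m"
      have "lookup \<alpha> j = 0"
      proof (rule ccontr)
        assume "lookup \<alpha> j \<noteq> 0"
        then have eq: "\<alpha> = \<alpha> - single j 1 + single j 1"
          by (simp add: monomial_minus_plus)
        have "mdeg \<alpha> = mdeg (\<alpha> - single j 1) + 1"
          by (subst eq) (simp only: mdeg_add mdeg_single)
        then have "\<alpha> - single j 1 \<in> monomials m" using \<alpha> by (simp add: monomials_def)
        with eq \<alpha> show False by blast
      qed
      then show "?F \<alpha> = 0" by simp
    qed
  qed (use finite_monomials in \<open>auto simp: monomials_def mdeg_add\<close>)
  also have "\<dots> = L m (\<lambda>\<beta>. of_nat (Suc (lookup \<beta> j)) * c (\<beta> + single j 1)) f"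
    unfolding L_def by (subst sum.reindex) (auto simp: inj_on_def lookup_add add.commute[of 1])
  finally show ?thesis
    unfolding L_def[of "Suc m"] T_y_mult
    by (simp add: sum_distrib_left sum.distrib algebra_simps)
qed

text \<open>The commutators of an operator that vanishes everywhere vanish too. They bring every
  coefficient down to order 0, where it is read off at the polynomial 1.\<close>

lemma L_independent: "(\<And>f. L m c f = 0) \<Longrightarrow> mdeg \<alpha> = m \<Longrightarrow> c \<alpha> = 0"
proof (induction m arbitrary: c \<alpha>)
  case 0
  then show ?case using L_0[of c 1] by (simp add: mdeg_eq_0_iff)
next
  case (Suc m)
  then have "\<alpha> \<noteq> 0" by auto
  then obtain j where j: "lookup \<alpha> j \<noteq> 0" by (rule ex_lookup_nonzero)
  define \<beta> where "\<beta> = \<alpha> - single j 1"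
  have \<alpha>: "\<alpha> = \<beta> + single j 1" using j by (simp add: \<beta>_def monomial_minus_plus)
  then have "mdeg \<beta> = m" using Suc.prems(2) by (simp add: mdeg_add)
  moreover have "L m (\<lambda>\<beta>. of_nat (Suc (lookup \<beta> j)) * c (\<beta> + single j 1)) f = 0" for f
    using L_commutator[of m c j f] Suc.prems(1) by simp
  ultimately have "of_nat (Suc (lookup \<beta> j)) * c \<alpha> = 0"
    using Suc.IH \<alpha> by blast
  then have "0 dvd of_nat (Suc (lookup \<beta> j)) * c \<alpha>"
    by (simp only: dvd_refl)
  then have "0 dvd c \<alpha>" by (rule of_nat_Suc_cancel)
  then show ?case by simp
qed

lemma Theta_independent:
  assumes "(\<Sum>\<alpha>\<in>monomials m. scale (c \<alpha>) (Theta \<alpha>)) = 0" "\<alpha> \<in> monomials m"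
  shows "c \<alpha> = 0"
proof (rule L_independent)
  show "L m c f = 0" for f
    unfolding L_eq_op_apply assms(1) by simp
  show "mdeg \<alpha> = m" using assms(2) by (simp add: monomials_def)
qed

lemma L_dvd:
  assumes "\<And>f. (\<Prod>i\<in>I. y i) dvd L m c (f * (\<Prod>i\<in>I. y i))"
    and "mdeg \<alpha> = m" "i \<in> I" "lookup \<alpha> i \<noteq> 0"
  shows "y i dvd c \<alpha>"
  using assms
proof (induction m arbitrary: c \<alpha>)
  case 0
  then show ?case by (simp add: mdeg_eq_0_iff)
next
  case (Suc m)
  let ?p = "\<Prod>i\<in>I. y i"
  let ?c = "\<lambda>j \<beta>. of_nat (Suc (lookup \<beta> j)) * c (\<beta> + single j 1)"
  show ?case
  proof (cases m)
    case 0
    \<comment> \<open>Order 1: on \<open>y i * q\<close> the operator gives \<open>y i\<close> times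
      its value on \<open>q\<close>, plus \<open>c \<alpha> * q\<close>. Since \<open>y i\<close>
      divides the result and is coprime to \<open>q\<close>, it divides
      \<open>c \<alpha>\<close>.\<close>
    define q where "q = (\<Prod>i\<in>I - {i}. y i)"
    have p: "?p = y i * q"
      unfolding q_def by (rule prod.remove) (use Suc.prems in auto)
    define \<beta> where "\<beta> = \<alpha> - single i 1"
    have \<alpha>: "\<alpha> = \<beta> + single i 1"
      using Suc.prems by (simp add: \<beta>_def monomial_minus_plus)
    then have "\<beta> = 0" using Suc.prems(2) 0 by (simp add: mdeg_add mdeg_eq_0_iff)
    have "y i dvd L (Suc m) c ?p"
      using Suc.prems(1)[of 1] p by (metis dvd_mult_left mult_1)
    then have "y i dvd c \<alpha> * q"
      unfolding p L_commutator 0 L_0 by (simp add: \<alpha> \<open>\<beta> = 0\<close> dvd_add_right_iff)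
    then show ?thesis unfolding q_def by (rule y_dvd_cancel[rotated]) simp
  next
    case (Suc m')
    \<comment> \<open>The commutator must keep \<open>i\<close> in the support. If
      \<open>\<alpha>\<close> contains another variable, that one is lowered; otherwise
      \<open>\<alpha>\<close> is a multiple of \<open>single i 1\<close> of degree at least 2, and
      \<open>i\<close> itself can be lowered.\<close>
    obtain j where j: "lookup \<alpha> j \<noteq> 0" "lookup (\<alpha> - single j 1) i \<noteq> 0"
    proof (cases "\<exists>j. j \<noteq> i \<and> lookup \<alpha> j \<noteq> 0")
      case True
      then show ?thesis using that Suc.prems(4) by (auto simp: lookup_minus lookup_single)
    next
      case False
      then have "mdeg \<alpha> = lookup \<alpha> i"
        unfolding mdeg_def by (subst sum.remove[of _ i]) auto
      then show ?thesis using that[of i] \<open>mdeg \<alpha> = Suc m\<close> Suc by (simp add: lookup_minus)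
    qed
    define \<beta> where "\<beta> = \<alpha> - single j 1"
    have \<alpha>: "\<alpha> = \<beta> + single j 1" using j by (simp add: \<beta>_def monomial_minus_plus)
    then have "mdeg \<beta> = m" using \<open>mdeg \<alpha> = Suc m\<close> by (simp add: mdeg_add)
    moreover have "?p dvd L m (?c j) (f * ?p)" for f
    proof -
      have "?p dvd L (Suc m) c ((y j * f) * ?p)" "?p dvd y j * L (Suc m) c (f * ?p)"
        using \<open>\<And>f. ?p dvd L (Suc m) c (f * ?p)\<close> by (blast intro: dvd_mult)+
      then show ?thesis by (simp only: mult.assoc L_commutator dvd_add_right_iff)
    qed
    ultimately have "y i dvd ?c j \<beta>"
      using Suc.IH[of "?c j" \<beta>] Suc.prems(3) j(2) \<beta>_def by blast
    then show ?thesis unfolding \<alpha> by (rule of_nat_Suc_cancel)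
  qed
qed

text \<open>Moving \<open>y j\<close> past the monomial gives a term that still has the factor
  \<open>y j\<close> and one that lost it. The second occurs only if \<open>\<alpha>\<close>
  contains \<open>j\<close>, and then the support product supplies the missing factor. The induction
  hypothesis is used at \<open>\<alpha>\<close> and at \<open>\<alpha> - single j 1\<close>, which
  have the same support in \<open>J\<close>.\<close>

lemma T_preserves:
  "(\<Prod>i\<in>J. y i) dvd (\<Prod>i\<in>{i\<in>J. lookup \<alpha> i \<noteq> 0}. y i) * T \<alpha> (f * (\<Prod>i\<in>J. y i))"
proof (induction J arbitrary: \<alpha> f rule: infinite_finite_induct)
  case (insert j J)
  let ?p = "\<Prod>i\<in>J. y i" and ?q = "\<lambda>\<alpha>. \<Prod>i\<in>{i\<in>J. lookup \<alpha> i \<noteq> 0}. y i"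
  have T: "T \<alpha> (f * (\<Prod>i\<in>insert j J. y i)) =
      y j * T \<alpha> (f * ?p) + of_nat (lookup \<alpha> j) * T (\<alpha> - single j 1) (f * ?p)"
    using insert.hyps T_y_mult[of \<alpha> j "f * ?p"] by (simp add: mult_ac)
  show ?case
  proof (cases "lookup \<alpha> j = 0")
    case True
    then have "{i \<in> insert j J. lookup \<alpha> i \<noteq> 0} = {i \<in> J. lookup \<alpha> i \<noteq> 0}" by auto
    with T True insert show ?thesis
      by (simp add: mult.left_commute[of _ "y j"] mult_dvd_mono)
  next
    case False
    then have "{i \<in> insert j J. lookup \<alpha> i \<noteq> 0} = insert j {i \<in> J. lookup \<alpha> i \<noteq> 0}" by auto
    then have q: "(\<Prod>i\<in>{i \<in> insert j J. lookup \<alpha> i \<noteq> 0}. y i) = y j * ?q \<alpha>"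
      using insert.hyps by simp
    have "?q (\<alpha> - single j 1) = ?q \<alpha>"
      using insert.hyps by (intro prod.cong) (auto simp: lookup_minus lookup_single when_def)
    then have *: "?p dvd ?q \<alpha> * T (\<alpha> - single j 1) (f * ?p)"
      using insert.IH[of "\<alpha> - single j 1" f] by simp
    have "?p dvd y j * (?q \<alpha> * T \<alpha> (f * ?p)) +
        of_nat (lookup \<alpha> j) * (?q \<alpha> * T (\<alpha> - single j 1) (f * ?p))"
      by (rule dvd_add[OF dvd_mult[OF insert.IH] dvd_mult[OF *]])
    then have dvd: "y j * ?p dvd y j * (y j * (?q \<alpha> * T \<alpha> (f * ?p)) +
        of_nat (lookup \<alpha> j) * (?q \<alpha> * T (\<alpha> - single j 1) (f * ?p)))"
      by (rule mult_dvd_mono[OF dvd_refl])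
    have "(\<Prod>i\<in>{i \<in> insert j J. lookup \<alpha> i \<noteq> 0}. y i) * T \<alpha> (f * (\<Prod>i\<in>insert j J. y i)) =
        y j * (y j * (?q \<alpha> * T \<alpha> (f * ?p)) +
        of_nat (lookup \<alpha> j) * (?q \<alpha> * T (\<alpha> - single j 1) (f * ?p)))"
      unfolding T q by (simp only: algebra_simps)
    with dvd show ?thesis
      by (simp only: prod.insert[OF insert.hyps])
  qed
qed simp_all

section \<open>The Theta monomials span the operators of a given order\<close>

lemma const_op_Theta: "const_op (mdeg \<alpha>) (Theta \<alpha>)"
proof (induction \<alpha> rule: monomial_induct)
  case 0
  show ?case using const_op_single[of 0 0 1] homogeneous_single[of 0 0 1] by simp
next
  case (add \<alpha> i)
  have "const_op 1 (Th i)"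
    unfolding Th_def by (intro const_op_sum const_op_single homogeneous_single) simp_all
  from const_op_mult[OF add.IH this] show ?case
    by (simp only: Theta_plus_single mdeg_add mdeg_single)
qed

abbreviation span_Theta :: "nat \<Rightarrow> 'n diff_op set" where
  "span_Theta m \<equiv> scale.span (Theta ` monomials m)"

lemma span_Theta_mult_Th: "\<delta> \<in> span_Theta m \<Longrightarrow> \<delta> * Th i \<in> span_Theta (Suc m)"
proof (induction rule: scale.span_induct_alt)
  case (step s \<eta> \<delta>)
  then obtain \<alpha> where \<alpha>: "mdeg \<alpha> = m" "\<eta> = Theta \<alpha>" by (auto simp: monomials_def)
  then have "\<eta> * Th i \<in> span_Theta (Suc m)"
    by (auto intro!: scale.span_base image_eqI[of _ _ "\<alpha> + single i 1"]
        simp: monomials_def mdeg_add Theta_plus_single[symmetric] simp del: One_nat_def)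
  then show ?case using step
    by (simp add: distrib_right scale_eq_mult[of s] mult.assoc)
       (simp add: scale_eq_mult[symmetric] scale.span_add scale.span_scale)
qed (simp add: scale.span_zero)

text \<open>By \<open>PY\<close> the \<open>j\<close>-th partial derivative is the combination of
  the \<open>Th i\<close> with coefficients \<open>Y i j\<close>, so one partial derivative can be
  exchanged at a time.\<close>

lemma single_in_span_Theta: "single \<beta> 1 \<in> span_Theta (mdeg \<beta>)"
proof (induction \<beta> rule: monomial_induct)
  case 0
  then show ?case
    by (auto intro!: scale.span_base image_eqI[of _ _ 0] simp: monomials_def)
next
  case (add \<beta> j)
  have "(\<Sum>i\<in>UNIV. scale (const (Y i j)) (Th i)) = single (single j 1) (1 :: 'n cpoly)"
  proof -
    have "(\<Sum>i\<in>UNIV. scale (const (Y i j)) (Th i)) =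
          (\<Sum>k\<in>UNIV. \<Sum>i\<in>UNIV. single (single k 1) (const (P k i * Y i j)))"
      unfolding Th_def scale.scale_sum_right
      by (subst sum.swap) (simp add: scale_eq_mult mult_single mult.commute)
    also have "\<dots> = (\<Sum>k\<in>UNIV. single (single k 1) (const (\<Sum>i\<in>UNIV. P k i * Y i j)))"
    proof (rule sum.cong)
      fix k
      show "(\<Sum>i\<in>UNIV. single (single k 1) (const (P k i * Y i j))) =
            single (single k (1::nat)) (const (\<Sum>i\<in>UNIV. P k i * Y i j) :: 'n cpoly)"
        by (intro poly_mapping_eqI) (simp add: lookup_sum lookup_single when_def)
    qed simp
    also have "\<dots> = (\<Sum>k\<in>UNIV. if k = j then single (single j 1) 1 else 0)"
      by (intro sum.cong) (auto simp: PY)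
    finally show ?thesis by simp
  qed
  then have "single (\<beta> + single j 1) (1 :: 'n cpoly) =
      single \<beta> 1 * (\<Sum>i\<in>UNIV. scale (const (Y i j)) (Th i))"
    by (simp add: mult_single)
  also have "\<dots> = (\<Sum>i\<in>UNIV. scale (const (Y i j)) (single \<beta> 1 * Th i))"
    by (simp add: sum_distrib_left scale_eq_mult mult_ac)
  also have "\<dots> \<in> span_Theta (Suc (mdeg \<beta>))"
    by (intro scale.span_sum scale.span_scale span_Theta_mult_Th add.IH)
  finally show ?case by (simp add: mdeg_add One_nat_def)
qed

lemma Theta_spanning:
  assumes "\<And>\<alpha>. \<alpha> \<in> keys \<delta> \<Longrightarrow> mdeg \<alpha> = m"
  obtains c where "\<delta> = (\<Sum>\<alpha>\<in>monomials m. scale (c \<alpha>) (Theta \<alpha>))"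
proof -
  have "(\<Sum>\<alpha>\<in>keys \<delta>. scale (lookup \<delta> \<alpha>) (single \<alpha> 1)) \<in> span_Theta m"
    using assms single_in_span_Theta by (intro scale.span_sum scale.span_scale) blast
  then have "\<delta> \<in> span_Theta m" by (simp only: sum_single_scale)
  from scale.span_image_finite[OF finite_monomials this] that show ?thesis by blast
qed

definition support_prod :: "'n set \<Rightarrow> ('n \<Rightarrow>\<^sub>0 nat) \<Rightarrow> 'n cpoly" where
  "support_prod I \<alpha> = (\<Prod>i\<in>{i\<in>I. lookup \<alpha> i \<noteq> 0}. y i)"

lemma arr_ops_order_eq:
  "arr_ops_order (\<Prod>i\<in>I. y i) m =
     range (\<lambda>c. \<Sum>\<alpha>\<in>monomials m. scale (c \<alpha>) (scale (support_prod I \<alpha>) (Theta \<alpha>)))"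
    (is "?M = range ?F")
proof
  show "?M \<subseteq> range ?F"
  proof
    fix \<delta> assume \<delta>: "\<delta> \<in> ?M"
    then obtain c where c: "\<delta> = (\<Sum>\<alpha>\<in>monomials m. scale (c \<alpha>) (Theta \<alpha>))"
      using Theta_spanning[of \<delta> m] by (auto simp: arr_ops_order_def)
    have L: "(\<Prod>i\<in>I. y i) dvd L m c (f * (\<Prod>i\<in>I. y i))" for f
    proof -
      have "op_apply \<delta> (f * (\<Prod>i\<in>I. y i)) \<in> principal_ideal (\<Prod>i\<in>I. y i)"
        using \<delta> unfolding arr_ops_order_def arr_ops_def by (auto simp: principal_ideal_def)
      then show ?thesis
        unfolding L_eq_op_apply c[symmetric] by (auto simp: principal_ideal_def)
    qed
    have "\<exists>e. \<alpha> \<in> monomials m \<longrightarrow> c \<alpha> = e * support_prod I \<alpha>" for \<alpha>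
    proof (cases "\<alpha> \<in> monomials m")
      case True
      have "support_prod I \<alpha> dvd c \<alpha>"
        unfolding support_prod_def
      proof (rule prod_y_dvd)
        fix i assume "i \<in> {i \<in> I. lookup \<alpha> i \<noteq> 0}"
        with True show "y i dvd c \<alpha>"
          by (intro L_dvd[OF L]) (auto simp: monomials_def)
      qed
      then obtain e where "c \<alpha> = support_prod I \<alpha> * e" by (rule dvdE)
      then show ?thesis by (intro exI[of _ e] impI) (simp only: mult.commute)
    qed simp
    then obtain e where e: "\<And>\<alpha>. \<alpha> \<in> monomials m \<Longrightarrow> c \<alpha> = e \<alpha> * support_prod I \<alpha>"
      by metis
    have "\<delta> = ?F e"
      unfolding c by (rule sum.cong) (simp_all add: e)
    then show "\<delta> \<in> range ?F" by (rule image_eqI[where x = e]) simp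
  qed
next
  show "range ?F \<subseteq> ?M"
  proof clarify
    fix c
    have "(\<Prod>i\<in>I. y i) dvd op_apply (?F c) (f * (\<Prod>i\<in>I. y i))" for f
      unfolding op_apply_sum op_apply_scale support_prod_def
      by (rule dvd_sum, rule dvd_mult, rule T_preserves)
    then have "?F c \<in> arr_ops (\<Prod>i\<in>I. y i)"
      by (auto simp: arr_ops_def principal_ideal_def dvd_def mult.commute)
    \<comment> \<open>\<open>arr_ops_order\<close> measures order in the original partial
      derivatives; \<open>const_op_Theta\<close> transfers it from the Theta monomials.\<close>
    moreover have "mdeg \<alpha> = m" if "\<alpha> \<in> keys (?F c)" for \<alpha>
    proof -
      from that obtain \<beta> where \<beta>: "\<beta> \<in> monomials m"
          "c \<beta> * (support_prod I \<beta> * lookup (Theta \<beta>) \<alpha>) \<noteq> 0"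
        unfolding in_keys_iff lookup_sum lookup_scale by (meson sum.neutral)
      then have "lookup (Theta \<beta>) \<alpha> \<noteq> 0" by auto
      with \<beta>(1) show ?thesis using const_op_Theta[of \<beta>] by (auto simp: const_op_def monomials_def)
    qed
    ultimately show "?F c \<in> ?M" by (simp add: arr_ops_order_def)
  qed
qed

lemma betti_arr_ops_order:
  "betti (arr_ops_order (\<Prod>i\<in>I. y i) m) u k =
     (if u = 0 then card {\<alpha>\<in>monomials m. card {i\<in>I. lookup \<alpha> i \<noteq> 0} = k} else 0)"
proof -
  let ?A = "monomials m :: ('n \<Rightarrow>\<^sub>0 nat) set"
  define w where "w \<alpha> = card {i\<in>I. lookup \<alpha> i \<noteq> 0}" for \<alpha> :: "'n \<Rightarrow>\<^sub>0 nat"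
  define B where "B \<alpha> = scale (support_prod I \<alpha>) (Theta \<alpha>)" for \<alpha>
  \<comment> \<open>\<open>graded_basis\<close> numbers its basis by an initial segment. The
    enumeration \<open>e\<close> and its left inverse \<open>e'\<close> translate between families
    on numbers and families on exponents.\<close>
  obtain e where e: "bij_betw e {..<card ?A} ?A"
    using ex_bij_betw_nat_finite[OF finite_monomials] by (auto simp: atLeast0LessThan)
  have sum_e: "(\<Sum>l<card ?A. scale (c (e l)) (B (e l))) = (\<Sum>\<alpha>\<in>?A. scale (c \<alpha>) (B \<alpha>))" for c
    by (rule sum.reindex_bij_betw[OF e])
  obtain e' where e': "\<And>l. l < card ?A \<Longrightarrow> e' (e l) = l"
    using e by (metis bij_betw_inv_into_left lessThan_iff)
  have sum_e': "(\<Sum>l<card ?A. scale (c l) (B (e l))) = (\<Sum>\<alpha>\<in>?A. scale (c (e' \<alpha>)) (B \<alpha>))" for c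
    by (subst sum_e[symmetric]) (simp add: e')
  have e_in: "e l \<in> ?A" if "l < card ?A" for l
    using e that by (auto simp: bij_betw_def)
  interpret graded_basis "arr_ops_order (\<Prod>i\<in>I. y i) m" "card ?A" "B \<circ> e" "w \<circ> e"
  proof
    fix c :: "nat \<Rightarrow> 'n cpoly" and l
    assume 0: "(\<Sum>l<card ?A. scale (c l) ((B \<circ> e) l)) = 0" and l: "l < card ?A"
    have "(\<Sum>\<alpha>\<in>?A. scale (c (e' \<alpha>) * support_prod I \<alpha>) (Theta \<alpha>)) = 0"
      using 0 sum_e'[of c] by (simp add: B_def)
    from Theta_independent[OF this e_in[OF l]] show "c l = 0"
      using e'[OF l] prod_y_cancel by (simp add: support_prod_def)
  next
    fix l
    have "homogeneous (w \<alpha>) (support_prod I \<alpha>)" for \<alpha>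
    proof -
      have "homogeneous (card J) (\<Prod>i\<in>J. y i)" for J :: "'n set"
      proof (induction J rule: infinite_finite_induct)
        case (insert i J)
        then show ?case
          using homogeneous_mult[OF homogeneous_y[of i] insert.IH] by (simp add: One_nat_def)
      qed (use homogeneous_single[of 0 0 1] in simp_all)
      then show ?thesis by (simp add: support_prod_def w_def)
    qed
    moreover have "homogeneous 0 (lookup (Theta \<alpha>) \<beta>)" for \<alpha> \<beta>
      using const_op_Theta by (simp add: const_op_def)
    ultimately have "homogeneous (w \<alpha>) (lookup (B \<alpha>) \<beta>)" for \<alpha> \<beta>
      using homogeneous_mult[of "w \<alpha>" "support_prod I \<alpha>" 0] by (simp add: B_def lookup_scale)
    then show "graded_elem (\<lambda>_. 0) ((w \<circ> e) l) ((B \<circ> e) l)"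
      by (simp add: graded_elem_def homogeneous_def)
  next
    have "range (\<lambda>c. \<Sum>\<alpha>\<in>?A. scale (c \<alpha>) (B \<alpha>)) = range (\<lambda>c. \<Sum>l<card ?A. scale (c l) (B (e l)))"
    proof (intro equalityI subsetI; elim rangeE)
      fix x c assume "x = (\<Sum>\<alpha>\<in>?A. scale (c \<alpha>) (B \<alpha>))"
      then have "x = (\<Sum>l<card ?A. scale ((\<lambda>l. c (e l)) l) (B (e l)))" by (simp add: sum_e)
      then show "x \<in> range (\<lambda>c. \<Sum>l<card ?A. scale (c l) (B (e l)))"
        by (rule image_eqI[where x = "\<lambda>l. c (e l)"]) simp
    next
      fix x c assume "x = (\<Sum>l<card ?A. scale (c l) (B (e l)))"
      then have "x = (\<Sum>\<alpha>\<in>?A. scale ((\<lambda>\<alpha>. c (e' \<alpha>)) \<alpha>) (B \<alpha>))" by (simp add: sum_e')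
      then show "x \<in> range (\<lambda>c. \<Sum>\<alpha>\<in>?A. scale (c \<alpha>) (B \<alpha>))"
        by (rule image_eqI[where x = "\<lambda>\<alpha>. c (e' \<alpha>)"]) simp
    qed
    then show "arr_ops_order (\<Prod>i\<in>I. y i) m = range (\<lambda>c. \<Sum>l<card ?A. scale (c l) ((B \<circ> e) l))"
      by (simp add: arr_ops_order_eq B_def)
  qed
  have image: "e ` {l. l < card ?A \<and> w (e l) = k} = {\<alpha>\<in>?A. w \<alpha> = k}"
    using e by (auto simp: bij_betw_def)
  have "inj_on e {l. l < card ?A \<and> w (e l) = k}"
    using e by (auto simp: bij_betw_def inj_on_def)
  from card_image[OF this] have "card {l. l < card ?A \<and> w (e l) = k} = card {\<alpha>\<in>?A. w \<alpha> = k}"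
    unfolding image by (rule sym)
  then show ?thesis by (simp add: betti_eq w_def)
qed

end

section \<open>Counting monomials\<close>

text \<open>Subtracting 1 at each element of \<open>K\<close> leaves an arbitrary multiset of weight
  \<open>m - k\<close> on \<open>K\<close> together with the complement of \<open>I\<close>, a set
  of \<open>n - card I + k\<close> elements. If \<open>k > m\<close>, no such exponent exists and
  \<open>multichoose\<close> is 0 at the negative argument.\<close>

lemma card_monomials_support:
  fixes I K :: "'n::finite set"
  assumes K: "K \<subseteq> I" and k: "card K = k"
  shows "card {\<alpha>\<in>monomials m. {i\<in>I. lookup \<alpha> i \<noteq> 0} = K} =
           multichoose (CARD('n) - card I + k) (int m - int k)"
proof -
  let ?A = "{\<alpha>\<in>monomials m. {i\<in>I. lookup \<alpha> i \<noteq> 0} = K}" and ?J = "(UNIV - I) \<union> K"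
  define c :: "'n \<Rightarrow> nat" where "c i = (if i \<in> K then 1 else 0)" for i
  have sum_c: "(\<Sum>i\<in>UNIV. c i) = k"
    by (simp add: c_def k flip: sum.inter_filter)
  have c_le: "c i \<le> lookup \<alpha> i" if "\<alpha> \<in> ?A" for \<alpha> i
    using that by (auto simp: c_def Suc_le_eq One_nat_def)
  have size: "size X = (\<Sum>i\<in>UNIV. count X i)" for X :: "'n multiset"
    unfolding size_multiset_overloaded_eq by (rule sum.mono_neutral_left) (auto simp: not_in_iff)
  have card_J: "card ?J = CARD('n) - card I + k"
    using K k by (subst card_Un_disjoint) (auto simp: card_Diff_subset)
  show ?thesis
  proof (cases "k \<le> m")
    case False
    have "?A = {}"
    proof (rule ccontr)
      assume "?A \<noteq> {}"
      then obtain \<alpha> where \<alpha>: "\<alpha> \<in> ?A" by blast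
      have "(\<Sum>i\<in>UNIV. c i) \<le> (\<Sum>i\<in>UNIV. lookup \<alpha> i)"
        by (intro sum_mono c_le \<alpha>)
      then show False using \<alpha> False by (simp add: sum_c monomials_def mdeg_def)
    qed
    then have "card ?A = 0" by (simp only: card.empty)
    then show ?thesis using False by (simp add: multichoose_def)
  next
    case True
    define f :: "'n multiset \<Rightarrow> 'n \<Rightarrow>\<^sub>0 nat" where "f X = Poly_Mapping.Abs_poly_mapping (\<lambda>i. count X i + c i)" for X
    define g :: "('n \<Rightarrow>\<^sub>0 nat) \<Rightarrow> 'n multiset" where "g \<alpha> = Abs_multiset (\<lambda>i. lookup \<alpha> i - c i)" for \<alpha>
    have f: "lookup (f X) i = count X i + c i" for X i
      by (simp add: f_def)
    have g: "count (g \<alpha>) i = lookup \<alpha> i - c i" for \<alpha> i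
      by (simp add: g_def count_Abs_multiset)
    have "bij_betw f (multisets_of_size ?J (m - k)) ?A"
    proof (rule bij_betw_byWitness[where f' = g])
      show "\<forall>X\<in>multisets_of_size ?J (m - k). g (f X) = X"
        by (auto simp: multiset_eq_iff f g)
      show "\<forall>\<alpha>\<in>?A. f (g \<alpha>) = \<alpha>"
        using c_le by (auto intro!: poly_mapping_eqI simp: f g)
      show "f ` multisets_of_size ?J (m - k) \<subseteq> ?A"
      proof (rule image_subsetI)
        fix X assume "X \<in> multisets_of_size ?J (m - k)"
        then have X: "i \<in> K" if "i \<in># X" "i \<in> I" for i
          using that by (auto simp: multisets_of_size_def)
        have "size X = m - k" using \<open>X \<in> _\<close> by (simp add: multisets_of_size_def)
        then have "mdeg (f X) = m"
          using True by (simp add: mdeg_def f sum.distrib sum_c flip: size)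
        moreover have "{i\<in>I. lookup (f X) i \<noteq> 0} = K"
          using K by (auto simp: f c_def dest: X)
        ultimately show "f X \<in> ?A" by (simp add: monomials_def)
      qed
      show "g ` ?A \<subseteq> multisets_of_size ?J (m - k)"
      proof (rule image_subsetI)
        fix \<alpha> assume \<alpha>: "\<alpha> \<in> ?A"
        have "size (g \<alpha>) = (\<Sum>i\<in>UNIV. lookup \<alpha> i) - (\<Sum>i\<in>UNIV. c i)"
          unfolding size g by (rule sum_subtractf_nat) (rule c_le[OF \<alpha>])
        then have "size (g \<alpha>) = m - k"
          using \<alpha> by (simp add: sum_c monomials_def mdeg_def)
        moreover have "i \<in> ?J" if "i \<in># g \<alpha>" for i
          using that \<alpha> by (auto simp: g simp flip: count_greater_zero_iff)
        ultimately show "g \<alpha> \<in> multisets_of_size ?J (m - k)"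
          by (auto simp: multisets_of_size_def)
      qed
    qed
    then have "card ?A = (card ?J + (m - k) - 1) choose (m - k)"
      by (simp add: bij_betw_same_card[symmetric] card_multisets_of_size)
    also have "\<dots> = multichoose (CARD('n) - card I + k) (int m - int k)"
      using True unfolding card_J multichoose_def by (simp add: nat_diff_distrib)
    finally show ?thesis .
  qed
qed

lemma card_monomials_card_support:
  fixes I :: "'n::finite set"
  shows "card {\<alpha>\<in>monomials m. card {i\<in>I. lookup \<alpha> i \<noteq> 0} = k} =
           (card I choose k) * multichoose (CARD('n) - card I + k) (int m - int k)"
proof -
  let ?F = "\<lambda>K. {\<alpha>\<in>monomials m. {i\<in>I. lookup \<alpha> i \<noteq> 0} = K}"
  have "{\<alpha>\<in>monomials m. card {i\<in>I. lookup \<alpha> i \<noteq> 0} = k} = (\<Union>K\<in>{K. K \<subseteq> I \<and> card K = k}. ?F K)"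
    by auto
  then have "card {\<alpha>\<in>monomials m. card {i\<in>I. lookup \<alpha> i \<noteq> 0} = k} =
      card (\<Union>K\<in>{K. K \<subseteq> I \<and> card K = k}. ?F K)"
    by (simp only:)
  also have "\<dots> = (\<Sum>K\<in>{K. K \<subseteq> I \<and> card K = k}. card (?F K))"
    by (rule card_UN_disjoint) (auto intro: finite_subset[OF _ finite_monomials])
  also have "\<dots> = (\<Sum>K\<in>{K. K \<subseteq> I \<and> card K = k}. multichoose (CARD('n) - card I + k) (int m - int k))"
    by (rule sum.cong[OF refl], rule card_monomials_support) auto
  also have "\<dots> = (card I choose k) * multichoose (CARD('n) - card I + k) (int m - int k)"
    by (simp add: n_subsets)
  finally show ?thesis .
qed

section \<open>Generating functions\<close>

text \<open>The series \<open>(1 - X)\<^sup>-\<^sup>c\<close>, characterized below by a product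
  because the coefficients form only a commutative ring.\<close>

definition multichoose_fps :: "nat \<Rightarrow> 'a::comm_ring_1 fps" where
  "multichoose_fps c = Abs_fps (\<lambda>d. of_nat (multichoose c (int d)))"

lemma multichoose_Suc_Suc:
  "multichoose (Suc c) (int (Suc d)) = multichoose c (int (Suc d)) + multichoose (Suc c) (int d)"
  by (simp add: multichoose_def nat_add_distrib add.commute)

lemma multichoose_fps_mult: "multichoose_fps c * (1 - fps_X) ^ c = (1 :: 'a::comm_ring_1 fps)"
proof (induction c)
  case 0
  have "multichoose 0 (int d) = (if d = 0 then 1 else 0)" for d
    by (simp add: multichoose_def)
  then show ?case by (simp add: multichoose_fps_def fps_eq_iff)
next
  case (Suc c)
  have "multichoose_fps (Suc c) * (1 - fps_X) = (multichoose_fps c :: 'a fps)"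
  proof (rule fps_ext)
    fix d show "fps_nth (multichoose_fps (Suc c) * (1 - fps_X)) d = fps_nth (multichoose_fps c :: 'a fps) d"
      using multichoose_Suc_Suc[of c "d - 1"]
      by (cases d) (simp_all add: multichoose_fps_def right_diff_distrib, simp add: multichoose_def)
  qed
  then show ?case using Suc.IH by (simp add: mult.assoc[symmetric])
qed

text \<open>Summand \<open>k\<close> of the series is \<open>(r choose k) (X b)\<^sup>k\<close> over
  the power \<open>n - r + k\<close> of \<open>1 - X\<close>. Multiplication by the
  \<open>n\<close>-th power leaves exponent \<open>r - k\<close>, and the binomial theorem sums the
  result. The ring containing \<open>b\<close> is left open since the lemma serves both the series
  that involve \<open>t\<close> and those after \<open>t = -1\<close>.\<close>

lemma generating_function:
  fixes b :: "'a::comm_ring_1"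
  assumes "r \<le> n"
  shows "Abs_fps (\<lambda>m. \<Sum>k\<le>r. of_nat ((r choose k) * multichoose (n - r + k) (int m - int k)) * b ^ k) *
           (1 - fps_X) ^ n = (1 - fps_X + fps_X * fps_const b) ^ r"
proof -
  have "Abs_fps (\<lambda>m. \<Sum>k\<le>r. of_nat ((r choose k) * multichoose (n - r + k) (int m - int k)) * b ^ k) =
        (\<Sum>k\<le>r. of_nat (r choose k) * (fps_X * fps_const b) ^ k * multichoose_fps (n - r + k))"
  proof (rule fps_ext)
    fix m
    have "fps_nth (of_nat (r choose k) * (fps_X * fps_const b) ^ k * multichoose_fps (n - r + k)) m =
        of_nat ((r choose k) * multichoose (n - r + k) (int m - int k)) * b ^ k" for k
    proof -
      have "of_nat (r choose k) * (fps_X * fps_const b) ^ k * multichoose_fps (n - r + k) =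
          fps_const (of_nat (r choose k) * b ^ k) * (fps_X ^ k * multichoose_fps (n - r + k))"
        by (simp add: power_mult_distrib fps_of_nat[symmetric] mult_ac flip: fps_const_mult fps_const_power)
      moreover have "of_nat (multichoose c (int m - int k)) =
          (if m < k then 0 else fps_nth (multichoose_fps c) (m - k) :: 'a)" for c
        by (auto simp: multichoose_fps_def nat_diff_distrib multichoose_def)
      ultimately show ?thesis
        by (simp add: fps_X_power_mult_nth mult_ac)
    qed
    then show "fps_nth (Abs_fps (\<lambda>m. \<Sum>k\<le>r. of_nat ((r choose k) * multichoose (n - r + k) (int m - int k)) * b ^ k)) m =
        fps_nth (\<Sum>k\<le>r. of_nat (r choose k) * (fps_X * fps_const b) ^ k * multichoose_fps (n - r + k)) m"
      by (simp add: fps_sum_nth)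
  qed
  also have "\<dots> * (1 - fps_X) ^ n =
      (\<Sum>k\<le>r. of_nat (r choose k) * (fps_X * fps_const b) ^ k * (1 - fps_X) ^ (r - k))"
    unfolding sum_distrib_right
  proof (rule sum.cong)
    fix k assume "k \<in> {..r}"
    then have "n = (n - r + k) + (r - k)" using assms by simp
    then have "(1 - fps_X :: 'a fps) ^ n = (1 - fps_X) ^ (n - r + k) * (1 - fps_X) ^ (r - k)"
      by (metis power_add)
    then have "multichoose_fps (n - r + k) * (1 - fps_X) ^ n = (1 - fps_X :: 'a fps) ^ (r - k)"
      by (simp only: mult.assoc[symmetric] multichoose_fps_mult mult_1)
    then show "of_nat (r choose k) * (fps_X * fps_const b) ^ k * multichoose_fps (n - r + k) * (1 - fps_X) ^ n =
        of_nat (r choose k) * (fps_X * fps_const b) ^ k * (1 - fps_X) ^ (r - k)"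
      by (simp only: mult.assoc)
  qed simp
  also have "\<dots> = (fps_X * fps_const b + (1 - fps_X)) ^ r"
    by (simp only: binomial_ring)
  finally show ?thesis by (simp only: add.commute)
qed

text \<open>In the application the coefficients are again power series, so no field is available.
  The second assumption says that \<open>inverse\<close> really inverts the constant coefficient,
  which is what makes \<open>/\<close> a quotient.\<close>

lemma fps_divide_eqI:
  fixes Q f g :: "'a::{comm_ring_1,inverse} fps"
  assumes "Q * g = f" and "inverse (fps_nth g 0) * fps_nth g 0 = 1"
  shows "f / g = Q"
proof -
  have "fps_nth g 0 \<noteq> 0" using assms(2) by auto
  then have "f / g = f * inverse g" by (rule fps_divide_unit)
  also have "\<dots> = Q * (g * fps_right_inverse g (inverse (fps_nth g 0)))"
    by (simp add: assms(1)[symmetric] fps_inverse_def mult.assoc)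
  also have "\<dots> = Q"
    using assms(2) by (simp add: fps_right_inverse mult.commute)
  finally show ?thesis .
qed

section \<open>Linear coordinates of a generic arrangement\<close>

definition form_vec :: "'n::finite cpoly \<Rightarrow> complex ^ 'n" where
  "form_vec l = (\<chi> j. lookup l (single j 1))"

definition vec_form :: "complex ^ 'n::finite \<Rightarrow> 'n cpoly" where
  "vec_form v = (\<Sum>j\<in>UNIV. single (single j 1) (v $ j))"

lemma mdeg_eq_1: "mdeg \<alpha> = 1 \<Longrightarrow> \<exists>j. \<alpha> = single j 1"
proof -
  assume \<alpha>: "mdeg \<alpha> = 1"
  then have "\<alpha> \<noteq> 0" by auto
  then obtain j where "lookup \<alpha> j \<noteq> 0" by (rule ex_lookup_nonzero)
  then have eq: "\<alpha> = \<alpha> - single j 1 + single j 1"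
    by (simp add: monomial_minus_plus)
  then have "mdeg \<alpha> = mdeg (\<alpha> - single j 1) + 1"
    using mdeg_add[of "\<alpha> - single j 1" "single j 1"] by simp
  with \<alpha> eq show ?thesis by (auto simp: mdeg_eq_0_iff)
qed

lemma vec_form_form_vec:
  assumes "homogeneous 1 l"
  shows "vec_form (form_vec l) = l"
proof (rule poly_mapping_eqI)
  fix \<alpha>
  have sum: "lookup (vec_form (form_vec l)) \<alpha> = (\<Sum>j\<in>UNIV. if \<alpha> = single j 1 then lookup l \<alpha> else 0)"
    unfolding vec_form_def lookup_sum
    by (rule sum.cong) (auto simp: lookup_single when_def form_vec_def)
  show "lookup (vec_form (form_vec l)) \<alpha> = lookup l \<alpha>"
  proof (cases "\<exists>j. \<alpha> = single j 1")
    case True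
    then obtain i where i: "\<alpha> = single i 1" by blast
    have "(\<alpha> = single j 1) = (j = i)" for j
      unfolding i by (metis lookup_single_eq lookup_single_not_eq zero_neq_one)
    then show ?thesis unfolding sum by simp
  next
    case False
    then have "\<alpha> \<notin> keys l"
      using assms mdeg_eq_1 unfolding homogeneous_def by blast
    then have "lookup l \<alpha> = 0" by (simp add: in_keys_iff)
    then show ?thesis unfolding sum using False by simp
  qed
qed

lemma poly_value_linear:
  assumes "homogeneous 1 l"
  shows "poly_value l z = (\<Sum>j\<in>UNIV. form_vec l $ j * z $ j)"
proof -
  let ?e = "\<lambda>j :: 'a. single j (1::nat)"
  have inj: "inj ?e"
    by (rule injI) (metis lookup_single_eq lookup_single_not_eq zero_neq_one)
  have "poly_value l z = (\<Sum>\<alpha>\<in>range ?e. lookup l \<alpha> * (\<Prod>i\<in>UNIV. (z $ i) ^ lookup \<alpha> i))"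
    unfolding poly_value_def
  proof (rule sum.mono_neutral_left)
    show "keys l \<subseteq> range ?e"
      using assms mdeg_eq_1 unfolding homogeneous_def by blast
  qed (auto simp: in_keys_iff)
  also have "\<dots> = (\<Sum>j\<in>UNIV. lookup l (?e j) * (\<Prod>i\<in>UNIV. (z $ i) ^ lookup (?e j) i))"
    by (subst sum.reindex[OF inj]) (simp add: o_def)
  also have "\<dots> = (\<Sum>j\<in>UNIV. form_vec l $ j * z $ j)"
  proof (rule sum.cong)
    fix j
    have "(\<Prod>i\<in>UNIV. (z $ i) ^ lookup (?e j) i) = (\<Prod>i\<in>UNIV. if i = j then z $ i else 1)"
      by (rule prod.cong) (auto simp: lookup_single when_def)
    then show "lookup l (?e j) * (\<Prod>i\<in>UNIV. (z $ i) ^ lookup (?e j) i) = form_vec l $ j * z $ j"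
      by (simp add: form_vec_def)
  qed simp
  finally show ?thesis .
qed

lemma generic_forms_independent:
  fixes l :: "(complex ^ 'n) set \<Rightarrow> 'n cpoly"
  assumes gen: "generic_arrangement \<A>" and card: "card \<A> \<le> CARD('n)"
    and l: "\<And>H. H \<in> \<A> \<Longrightarrow> defining_form H (l H)"
  shows "inj_on (form_vec \<circ> l) \<A>" and "vec.independent ((form_vec \<circ> l) ` \<A>)"
proof -
  let ?a = "form_vec \<circ> l"
  have mem: "z \<in> H \<longleftrightarrow> (\<Sum>j\<in>UNIV. ?a H $ j * z $ j) = 0" if "H \<in> \<A>" for H z
  proof -
    have h: "homogeneous 1 (l H)" and H: "H = {z. poly_value (l H) z = 0}"
      using l[OF that] unfolding defining_form_def by blast+
    from arg_cong[OF H, of "\<lambda>S. z \<in> S"] show ?thesis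
      unfolding mem_Collect_eq poly_value_linear[OF h] o_apply .
  qed
  have fin: "finite \<A>" using gen by (simp add: generic_arrangement_def arrangement_def)
  show inj: "inj_on ?a \<A>"
  proof (rule inj_onI)
    fix H H' assume "H \<in> \<A>" "H' \<in> \<A>" "?a H = ?a H'"
    then show "H = H'" by (intro set_eqI) (simp only: mem)
  qed
  show "vec.independent (?a ` \<A>)"
  proof
    assume "vec.dependent (?a ` \<A>)"
    then obtain H0 where H0: "H0 \<in> \<A>" "?a H0 \<in> vec.span (?a ` \<A> - {?a H0})"
      unfolding vec.dependent_def by blast
    have "\<Inter>(\<A> - {H0}) \<subseteq> H0"
    proof
      fix z assume z: "z \<in> \<Inter>(\<A> - {H0})"
      have "(\<Sum>j\<in>UNIV. ?a H0 $ j * z $ j) = 0"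
        using H0(2)
      \<comment> \<open>The vectors orthogonal to \<open>z\<close> for the bilinear pairing form a
        subspace that contains the vectors of all other hyperplanes.\<close>
      proof (induction rule: vec.span_induct)
        case (step x)
        then obtain H' where H': "H' \<in> \<A>" "H' \<noteq> H0" "x = ?a H'" by blast
        with z have "z \<in> H'" by blast
        with H' show ?case by (simp only: mem mem_Collect_eq)
      next
        case base
        show ?case
        proof (rule vec.subspaceI)
          fix c and x assume "x \<in> {x. (\<Sum>j\<in>UNIV. x $ j * z $ j) = 0}"
          then show "c *s x \<in> {x. (\<Sum>j\<in>UNIV. x $ j * z $ j) = 0}"
            by (simp add: mult.assoc flip: sum_distrib_left)
        qed (simp_all add: distrib_right sum.distrib)
      qed
      then show "z \<in> H0" by (simp only: mem[OF H0(1)])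
    qed
    then have Inter: "\<Inter>(\<A> - {H0}) = \<Inter>\<A>"
      using H0(1) by auto
    have less: "card (\<A> - {H0}) < card \<A>"
      using fin H0(1) by (rule card_Diff1_less)
    have dim: "vec.dim (\<Inter>\<B>) + card \<B> = CARD('n)" if "\<B> \<subseteq> \<A>" "card \<B> \<le> CARD('n)" for \<B>
      using gen that by (simp add: generic_arrangement_def)
    \<comment> \<open>Genericity makes both sums equal to n, but the two intersections coincide
      while the numbers of hyperplanes differ.\<close>
    have "vec.dim (\<Inter>(\<A> - {H0})) + card (\<A> - {H0}) = vec.dim (\<Inter>\<A>) + card \<A>"
      using less card by (subst (1 2) dim) auto
    with less show False unfolding Inter by simp
  qed
qed

text \<open>The vectors extend to a basis, which is indexed by the type of the variables and written
  into the rows of a square matrix. Independent rows give a right inverse, which is two-sided and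
  serves as \<open>P\<close>.\<close>

lemma independent_vectors_linear_coords:
  fixes V :: "(complex ^ 'n) set"
  assumes V: "vec.independent V"
  obtains b :: "'n \<Rightarrow> complex ^ 'n" and P :: "'n \<Rightarrow> 'n \<Rightarrow> complex"
  where "inj b" "V \<subseteq> range b" "linear_coords (\<lambda>i j. b i $ j) P"
proof -
  define B where "B = vec.extend_basis V"
  have B: "V \<subseteq> B" "vec.independent B" "vec.span B = UNIV"
    unfolding B_def
    by (rule vec.extend_basis_superset[OF V] vec.independent_extend_basis[OF V] vec.span_extend_basis[OF V])+
  have fin: "finite B" using B(2) by (rule vec.finiteI_independent)
  have "card B = CARD('n)"
    using vec.dim_eq_card[of B UNIV] B by (simp add: card_cart_basis)
  then obtain b where b: "bij_betw b (UNIV :: 'n set) B"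
    using finite_same_card_bij[of "UNIV :: 'n set" B] fin by auto
  define M :: "complex ^ 'n ^ 'n" where "M = (\<chi> i. b i)"
  have "c i = 0" if "(\<Sum>i\<in>UNIV. c i *s row i M) = 0" for c i
  proof -
    \<comment> \<open>The matrix criterion indexes coefficients by rows, whereas independence of
      \<open>B\<close> indexes them by vectors; the inverse of \<open>b\<close> mediates.\<close>
    have inv: "the_inv b (b i) = i" for i
      using b by (simp add: bij_betw_def the_inv_f_f)
    have "row i M = b i" for i
      by (simp add: M_def row_def vec_eq_iff)
    then have "(\<Sum>i\<in>UNIV. c (the_inv b (b i)) *s b i) = 0"
      using that by (simp add: inv)
    then have "(\<Sum>v\<in>B. c (the_inv b v) *s v) = 0"
      using sum.reindex_bij_betw[OF b, of "\<lambda>v. c (the_inv b v) *s v"] by simp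
    from vec.independentD[OF B(2) fin subset_refl this, of "b i"] show "c i = 0"
      using b inv by (auto simp: bij_betw_def)
  qed
  then obtain Q where Q: "M ** Q = mat 1"
    using matrix_right_invertible_independent_rows[of M] by blast
  then have Q': "Q ** M = mat 1" by (simp add: matrix_left_right_inverse)
  have "linear_coords (\<lambda>i j. b i $ j) (\<lambda>i j. Q $ i $ j)"
  proof
    fix i k
    show "(\<Sum>j\<in>UNIV. b i $ j * Q $ j $ k) = (if i = k then 1 else 0)"
      using arg_cong[OF Q, of "\<lambda>A. A $ i $ k"] by (simp add: matrix_matrix_mult_def M_def mat_def)
    show "(\<Sum>j\<in>UNIV. Q $ i $ j * b j $ k) = (if i = k then 1 else 0)"
      using arg_cong[OF Q', of "\<lambda>A. A $ i $ k"] by (simp add: matrix_matrix_mult_def M_def mat_def)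
  qed
  then show thesis using b B(1) by (intro that) (auto simp: bij_betw_def)
qed

lemma betti_generic_arrangement:
  fixes \<A> :: "(complex ^ 'n) set set" and p :: "'n cpoly"
  assumes gen: "generic_arrangement \<A>" and card: "card \<A> \<le> CARD('n)"
    and p: "defining_polynomial \<A> p"
  shows "betti (arr_ops_order p m) u k =
           (if u = 0 then (card \<A> choose k) * multichoose (CARD('n) - card \<A> + k) (int m - int k) else 0)"
proof -
  obtain l where l: "\<And>H. H \<in> \<A> \<Longrightarrow> defining_form H (l H)" and p: "p = (\<Prod>H\<in>\<A>. l H)"
    using p by (auto simp: defining_polynomial_def)
  let ?a = "form_vec \<circ> l"
  note indep = generic_forms_independent[OF gen card l]
  obtain b P where b: "inj b" "?a ` \<A> \<subseteq> range b" "linear_coords (\<lambda>i j. b i $ j) P"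
    using independent_vectors_linear_coords[OF indep(2)] by blast
  interpret linear_coords "\<lambda>i j. b i $ j" P by (rule b(3))
  \<comment> \<open>The indices whose coordinate is one of the given forms. The forms themselves,
    and not just multiples of them, are coordinates, so the product over \<open>I\<close> is exactly
    \<open>p\<close>.\<close>
  define I where "I = b -` ?a ` \<A>"
  have bij: "bij_betw b I (?a ` \<A>)"
    unfolding bij_betw_def I_def using b(1,2)
    by (auto simp: image_vimage_eq intro: inj_on_subset)
  have "(\<Prod>i\<in>I. y i) = (\<Prod>i\<in>I. vec_form (b i))"
    by (simp add: y_def vec_form_def)
  also have "\<dots> = (\<Prod>v\<in>?a ` \<A>. vec_form v)"
    by (rule prod.reindex_bij_betw[OF bij])
  also have "\<dots> = (\<Prod>H\<in>\<A>. vec_form (?a H))"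
    by (rule prod.reindex_cong[OF indep(1)]) simp_all
  also have "\<dots> = p"
    unfolding p using l by (intro prod.cong) (auto simp: defining_form_def vec_form_form_vec)
  finally have "(\<Prod>i\<in>I. y i) = p" .
  moreover have "card I = card \<A>"
    using bij_betw_same_card[OF bij] card_image[OF indep(1)] by simp
  ultimately show ?thesis
    using betti_arr_ops_order[of I m u k] by (simp only: card_monomials_card_support)
qed

lemma fps_nth_sum_of_nat:
  assumes "\<And>k. k > r \<Longrightarrow> c k = 0"
  shows "fps_nth (\<Sum>k\<le>r. of_nat (c k) * fps_X ^ k) i = (of_nat (c i) :: 'a::comm_ring_1)"
proof -
  have "fps_nth (\<Sum>k\<le>r. of_nat (c k) * fps_X ^ k) i = (\<Sum>k\<le>r. if k = i then of_nat (c i) else (0 :: 'a))"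
    unfolding fps_sum_nth by (intro sum.cong) (auto simp: fps_of_nat[symmetric] fps_X_power_nth)
  also have "\<dots> = of_nat (c i)"
    using assms[of i] by (auto simp: not_le[symmetric])
  finally show ?thesis .
qed

text \<open>With homology only in degree \<open>u = 0\<close>, the series in \<open>t\<close> are
  constants and the substitution \<open>t = -1\<close> leaves them unchanged; the two sums have the
  same shape over different rings.\<close>

lemma poincare_eq:
  assumes "\<And>u k. betti M u k = (if u = 0 then c k else 0)" and "\<And>k. k > r \<Longrightarrow> c k = 0"
  shows "poincare M = (\<Sum>k\<le>r. of_nat (c k) * fps_X ^ k)"
    and "at_minus_one (poincare M) = (\<Sum>k\<le>r. of_nat (c k) * fps_X ^ k)"
proof -
  have *: "Abs_fps (\<lambda>j. real (betti M j i)) = of_nat (c i)" for i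
    by (simp add: assms(1) fps_eq_iff fps_of_nat[symmetric])
  show "poincare M = (\<Sum>k\<le>r. of_nat (c k) * fps_X ^ k)"
    by (rule fps_ext) (simp add: poincare_def * fps_nth_sum_of_nat assms(2))
  have "eval_fps (of_nat (c i)) (-1 :: real) = of_nat (c i)" for i
    by (simp flip: fps_of_nat)
  then show "at_minus_one (poincare M) = (\<Sum>k\<le>r. of_nat (c k) * fps_X ^ k)"
    by (intro fps_ext) (simp add: at_minus_one_def poincare_def * fps_nth_sum_of_nat assms(2))
qed

theorem lemma21:
  fixes \<A> :: "(complex ^ 'n) set set" and p :: "'n cpoly" and r :: nat
  assumes "1 \<le> r" and "r \<le> CARD('n)"
    and "generic_arrangement \<A>" and "card \<A> = r"
    and "defining_polynomial \<A> p"
  shows "(\<forall>m u k. betti (arr_ops_order p m) u k =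
            (if u > 0 then 0
             else (r choose k) * multichoose (CARD('n) - r + k) (int m - int k))) \<and>
         poincare_arr p =
          (1 - fps_X + fps_X * fps_const fps_X) ^ r / (1 - fps_X) ^ CARD('n) \<and>
         hilbert_arr p =
          (1 - fps_X + fps_X * fps_const fps_X) ^ r /
          ((1 - fps_X) ^ CARD('n) * (1 - fps_const fps_X) ^ CARD('n)) \<and>
         (\<forall>m. poincare (arr_ops_order p m) =
          fps_nth ((1 - fps_X + fps_X * fps_const fps_X) ^ r / (1 - fps_X) ^ CARD('n)) m) \<and>
         (\<forall>m. hilbert (arr_ops_order p m) =
          fps_nth ((1 - fps_X + fps_X * fps_const fps_X) ^ r /
          ((1 - fps_X) ^ CARD('n) * (1 - fps_const fps_X) ^ CARD('n))) m)"
proof -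
  let ?n = "CARD('n)"
  define c where "c m k = (r choose k) * multichoose (?n - r + k) (int m - int k)" for m k
  have betti: "betti (arr_ops_order p m) u k = (if u = 0 then c m k else 0)" for m u k
    using assms betti_generic_arrangement[of \<A> p m u k] by (simp add: c_def)
  have c0: "c m k = 0" if "k > r" for m k
    using that by (simp add: c_def)
  have poincare: "poincare (arr_ops_order p m) = (\<Sum>k\<le>r. of_nat (c m k) * fps_X ^ k)"
    "at_minus_one (poincare (arr_ops_order p m)) = (\<Sum>k\<le>r. of_nat (c m k) * fps_X ^ k)" for m
    by (rule poincare_eq[OF betti c0]; assumption)+
  have "poincare_arr p * (1 - fps_X) ^ ?n = (1 - fps_X + fps_X * fps_const fps_X) ^ r"
    unfolding poincare_arr_def poincare(1) c_def by (rule generating_function[OF assms(2)])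
  \<comment> \<open>The constant coefficient of the denominator in \<open>a\<close> is the 1 of the
    ring of series in \<open>b\<close> and \<open>t\<close>.\<close>
  moreover have "inverse (1 :: real fps fps) = 1"
    by (rule fps_inverse_one') simp
  ultimately have P: "poincare_arr p = (1 - fps_X + fps_X * fps_const fps_X) ^ r / (1 - fps_X) ^ ?n"
    by (intro fps_divide_eqI[symmetric]) (simp_all add: fps_nth_power_0)
  \<comment> \<open>The Hilbert series without the factor for
    \<open>(1 - b)\<^sup>-\<^sup>n\<close>.\<close>
  define G where "G = Abs_fps (\<lambda>m. at_minus_one (fps_nth (poincare_arr p) m))"
  have G: "G * (1 - fps_X) ^ ?n = (1 - fps_X + fps_X * fps_const fps_X) ^ r"
    unfolding G_def poincare_arr_def fps_nth_Abs_fps poincare(2) c_def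
    by (rule generating_function[OF assms(2)])
  have inv: "inverse ((1 - fps_X) ^ ?n) * (1 - fps_X) ^ ?n = (1 :: real fps)"
    by (rule inverse_mult_eq_1) (simp add: fps_nth_power_0)
  have const: "fps_const (inverse ((1 - fps_X) ^ ?n)) * (1 - fps_const fps_X) ^ ?n = (1 :: real fps fps)"
  proof -
    have "(1 - fps_const fps_X) ^ ?n = (fps_const ((1 - fps_X) ^ ?n) :: real fps fps)"
      by (simp flip: fps_const_power fps_const_sub)
    then show ?thesis by (simp only: fps_const_mult inv fps_const_1_eq_1)
  qed
  have "hilbert_arr p * ((1 - fps_X) ^ ?n * (1 - fps_const fps_X) ^ ?n) =
      (fps_const (inverse ((1 - fps_X) ^ ?n)) * (1 - fps_const fps_X) ^ ?n) * (G * (1 - fps_X) ^ ?n)"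
    unfolding hilbert_arr_def G_def[symmetric] by (simp only: mult_ac)
  also have "\<dots> = (1 - fps_X + fps_X * fps_const fps_X) ^ r"
    by (simp only: const G mult_1)
  finally have H: "hilbert_arr p = (1 - fps_X + fps_X * fps_const fps_X) ^ r /
          ((1 - fps_X) ^ ?n * (1 - fps_const fps_X) ^ ?n)"
    \<comment> \<open>As a series in \<open>a\<close>, the denominator has constant coefficient
      \<open>(1 - b)\<^sup>n\<close>, which is invertible by \<open>inv\<close>.\<close>
    by (intro fps_divide_eqI[symmetric]) (simp_all add: fps_nth_power_0 inv)
  show ?thesis
  proof (intro conjI allI)
    show "betti (arr_ops_order p m) u k =
        (if u > 0 then 0 else (r choose k) * multichoose (?n - r + k) (int m - int k))" for m u k
      unfolding betti c_def by simp
    show "poincare (arr_ops_order p m) =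
        fps_nth ((1 - fps_X + fps_X * fps_const fps_X) ^ r / (1 - fps_X) ^ ?n) m" for m
      unfolding P[symmetric] by (simp add: poincare_arr_def)
    show "hilbert (arr_ops_order p m) =
        fps_nth ((1 - fps_X + fps_X * fps_const fps_X) ^ r /
          ((1 - fps_X) ^ ?n * (1 - fps_const fps_X) ^ ?n)) m" for m
      unfolding H[symmetric] by (simp add: hilbert_arr_def hilbert_def poincare_arr_def)
  qed (fact P, fact H)
qed

end
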